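(* Let $p:\mathbb{R}^n\to[1,\infty)$ be a measurable function such that $p_->1$ and $p_+<\infty$. Let $w$ be a weight (i.e. a non-negative function such that $w(\cdot)^{p(\cdot)}$ and $w(\cdot)^{-p'(\cdot)}$ are locally integrable) such that $w(\cdot)^{p(\cdot)}\in A_\infty$. If the Hardy–Littlewood maximal operator $M$ is bounded on $L^{p(\cdot)}_w$, then $M$ is bounded on $L^{p'(\cdot)}_{w^{-1}}$.
   Context: For measurable $p:\mathbb{R}^n\to[1,\infty)$: $p_-=\operatorname{ess\,inf}_{x\in\mathbb{R}^n}p(x)$, $p_+=\operatorname{ess\,sup}_{x\in\mathbb{R}^n}p(x)$, and $p'(x)=\frac{p(x)}{p(x)-1}$. The variable Lebesgue space $L^{p(\cdot)}$ is the space of measurable $f$ on $\mathbb{R}^n$ with $\int_{\mathbb{R}^n}|f(x)/\lambda|^{p(x)}dx<\infty$ for some $\lambda>0$, with norm $\|f\|_{L^{p(\cdot)}}=\inf\{\lambda>0:\int_{\mathbb{R}^n}|f(x)/\lambda|^{p(x)}dx\le 1\}$. The weighted space $L^{p(\cdot)}_w$ has norm $\|f\|_{L^{p(\cdot)}_w}=\|fw\|_{L^{p(\cdot)}}$; likewise $\|f\|_{L^{p'(\cdot)}_{w^{-1}}}=\|fw^{-1}\|_{L^{p'(\cdot)}}$. The maximal operator is $Mf(x)=\sup_{Q\ni x}\frac1{|Q|}\int_Q|f(y)|dy$, the supremum over all cubes $Q\subset\mathbb{R}^n$ containing $x$. "$M$ is bounded on $X$" means there is $C>0$ with $\|Mf\|_X\le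 C\|f\|_X$ for all $f\in X$. A non-negative locally integrable $v$ is in $A_r$, $1<r<\infty$, if $\sup_Q\left(\frac1{|Q|}\int_Q v\,dx\right)\left(\frac1{|Q|}\int_Q v^{-\frac1{r-1}}dx\right)^{r-1}<\infty$, the supremum over all cubes; $A_\infty=\bigcup_{r>1}A_r$. *)

theory Defs
  imports "HOL-Analysis.Analysis" "HOL-Probability.Essential_Supremum"
begin

text \<open>
  Non-negative functions are extended-valued (type \<^typ>\<open>ennreal\<close>): the maximal
  function may take the value infinity, and so may a negative power of a weight. Measurability
  and integration refer to Lebesgue measure; \<^const>\<open>nn_integral\<close> is used throughout.
\<close>

definition essinf ::
    "'a measure \<Rightarrow> ('a \<Rightarrow> 'b::{second_countable_topology, dense_linorder, linorder_topology, complete_linorder}) \<Rightarrow> 'b"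
  where "essinf M f = (if f \<in> borel_measurable M then Liminf (ae_filter M) f else bot)"

text \<open>
  Real powers of extended non-negative numbers. For a negative exponent the value at 0 is
  infinity, whereas \<^term>\<open>(0::real) powr s\<close> is 0 for every \<^term>\<open>s\<close>. Hence a
  function with a locally integrable negative power is positive almost everywhere.
\<close>

definition epowr :: "ennreal \<Rightarrow> real \<Rightarrow> ennreal" where
  "epowr a s =
     (if s = 0 then 1
      else if a = 0 then (if s > 0 then 0 else \<infinity>)
      else if a = \<infinity> then (if s > 0 then \<infinity> else 0)
      else ennreal (enn2real a powr s))"

definition locally_integrable :: "(real^'n \<Rightarrow> ennreal) \<Rightarrow> bool" where
  "locally_integrable v \<longleftrightarrow>
     v \<in> borel_measurable lebesgue \<and>
     (\<forall>K. compact K \<longrightarrow> (\<integral>\<^sup>+x\<in>K. v x \<partial>lebesgue) < \<infinity>)"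

text \<open>
  Where \<^term>\<open>p x = 1\<close>, the value \<^term>\<open>p x / (p x - 1)\<close> is 0 instead of infinity. If
  the essential infimum of \<^term>\<open>p\<close> exceeds 1, this concerns a null set only and affects
  none of the integrals below.
\<close>

definition conj_exponent :: "(real^'n \<Rightarrow> real) \<Rightarrow> real^'n \<Rightarrow> real" where
  "conj_exponent p x = p x / (p x - 1)"

definition modular :: "(real^'n \<Rightarrow> real) \<Rightarrow> (real^'n \<Rightarrow> ennreal) \<Rightarrow> ennreal" where
  "modular p g = (\<integral>\<^sup>+x. epowr (g x) (p x) \<partial>lebesgue)"

text \<open>The Luxemburg norm of a function with absolute value \<^term>\<open>g\<close>; it is infinite if no
  \<^term>\<open>c\<close> is admissible.\<close>

definition Lp_norm :: "(real^'n \<Rightarrow> real) \<Rightarrow> (real^'n \<Rightarrow> ennreal) \<Rightarrow> ennreal" where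
  "Lp_norm p g = Inf {ennreal c | c. c > 0 \<and> modular p (\<lambda>x. g x / ennreal c) \<le> 1}"

definition weighted_Lp_norm ::
    "(real^'n \<Rightarrow> real) \<Rightarrow> (real^'n \<Rightarrow> ennreal) \<Rightarrow> (real^'n \<Rightarrow> ennreal) \<Rightarrow> ennreal" where
  "weighted_Lp_norm p w g = Lp_norm p (\<lambda>x. g x * w x)"

definition weighted_Lp :: "(real^'n \<Rightarrow> real) \<Rightarrow> (real^'n \<Rightarrow> ennreal) \<Rightarrow> (real^'n \<Rightarrow> real) set" where
  "weighted_Lp p w =
     {f \<in> borel_measurable lebesgue.
        \<exists>c>0. modular p (\<lambda>x. ennreal \<bar>f x\<bar> * w x / ennreal c) < \<infinity>}"

definition cubes :: "(real^'n) set set" where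
  "cubes = {cbox a (\<chi> i. a $ i + l) | a l. l > 0}"

definition average :: "(real^'n) set \<Rightarrow> (real^'n \<Rightarrow> ennreal) \<Rightarrow> ennreal" where
  "average Q g = (\<integral>\<^sup>+x\<in>Q. g x \<partial>lebesgue) / emeasure lebesgue Q"

definition maximal_op :: "(real^'n \<Rightarrow> real) \<Rightarrow> real^'n \<Rightarrow> ennreal" where
  "maximal_op f x = (SUP Q\<in>{Q\<in>cubes. x \<in> Q}. average Q (\<lambda>y. ennreal \<bar>f y\<bar>))"

definition maximal_op_bounded :: "(real^'n \<Rightarrow> real) \<Rightarrow> (real^'n \<Rightarrow> ennreal) \<Rightarrow> bool" where
  "maximal_op_bounded p w \<longleftrightarrow>
     (\<exists>C::real. C > 0 \<and>
       (\<forall>f\<in>weighted_Lp p w.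
          weighted_Lp_norm p w (maximal_op f)
            \<le> ennreal C * weighted_Lp_norm p w (\<lambda>x. ennreal \<bar>f x\<bar>)))"

text \<open>
  The product of 0 and infinity is 0 in \<^typ>\<open>ennreal\<close>. In the following supremum this
  matters only if \<^term>\<open>v\<close> vanishes almost everywhere on a cube; the supremum is then
  infinite unless \<^term>\<open>v\<close> vanishes almost everywhere.
\<close>

definition Muckenhoupt_A :: "real \<Rightarrow> (real^'n \<Rightarrow> ennreal) set" where
  "Muckenhoupt_A r =
     {v. locally_integrable v \<and>
        (SUP Q\<in>cubes. average Q v * epowr (average Q (\<lambda>x. epowr (v x) (- 1 / (r - 1)))) (r - 1))
          < \<infinity>}"

definition Muckenhoupt_A_inf :: "(real^'n \<Rightarrow> ennreal) set" where
  "Muckenhoupt_A_inf = (\<Union>r\<in>{1<..}. Muckenhoupt_A r)"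

definition is_weight :: "(real^'n \<Rightarrow> real) \<Rightarrow> (real^'n \<Rightarrow> real) \<Rightarrow> bool" where
  "is_weight p w \<longleftrightarrow>
     (\<forall>x. w x \<ge> 0) \<and>
     locally_integrable (\<lambda>x. epowr (ennreal (w x)) (p x)) \<and>
     locally_integrable (\<lambda>x. epowr (ennreal (w x)) (- conj_exponent p x))"

end

theory Submission
  imports Defs
begin

text \<open>
  Write \<open>X\<close> for the weighted space with exponent \<open>p\<close>. By the one-third trick and duality, it
  suffices to bound the sum of \<open>\<alpha>\<^sub>Q 1\<^sub>Q\<close> over a sparse family of cubes by
  the sum of \<open>\<alpha>\<^sub>Q 1\<^bsub>E(Q)\<^esub>\<close> in the norm of \<open>X\<close>, where \<open>E(Q)\<close> is the part of \<open>Q\<close> outside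
  the smaller cubes of the family and has at least half of its measure.

  Replace \<open>\<alpha>\<close> by its running maximum over larger cubes (a loss of a constant, since \<open>M\<close> is bounded
  on \<open>X\<close>) and round it down to powers of 2. Let \<open>U\<close> shift such a monotone family by one generation.
  The modular of \<open>\<alpha>\<close> exceeds that of \<open>U \<alpha>\<close> by at least half the modular of the restriction of
  \<open>\<alpha>\<close> to the cubes where it jumps. The running maximum of this restriction is \<open>\<alpha>\<close> again, so this
  loss is bounded below as long as the modular of \<open>\<alpha>\<close> is. Hence a fixed number of shifts halves the
  norm, the norms of the shifts decay geometrically, and their sum dominates the sum over
  \<open>Q\<close> of \<open>\<alpha>\<^sub>Q 1\<^sub>Q\<close>.
\<close>

section \<open>Shifts of coefficient families on a forest of sets\<close>

text \<open>\<open>M\<close> is not linear, so its boundedness has no direct dual; the averaging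
  operator of a sparse family does. Testing the sum of (mean of g over Q) \<open>1_E(Q)\<close>
  against f gives the sum of \<alpha>_Q times the integral of g over Q, where \<alpha>_Q is the
  integral of f over E(Q) divided by |Q|. The sum of \<alpha>_Q \<open>1_E(Q)\<close> lies below
  \<open>M f\<close>, which the hypothesis controls. But g is integrated over all of Q, and the sets
  Q, unlike the E(Q), overlap without bound: this is why \<open>1_Q\<close> must be compared with
  \<open>1_E(Q)\<close>. With a variable exponent the modular is not homogeneous; it only grows at
  least linearly and at most with power \<open>P\<close>. Rounding to powers of 2 turns every jump
  into a doubling, so that linear growth alone yields a definite loss; the power \<open>P\<close>
  tells how small the modular must become before the norm is halved. All constants depend on
  \<open>P\<close> and \<open>C\<close> only, never on the family. Finite families therefore
  suffice, and all cubes are reached at the end by Fatou's lemma.\<close>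

definition dyadic_value :: "real \<Rightarrow> bool" where
  "dyadic_value t \<longleftrightarrow> t = 0 \<or> (\<exists>i::int. t = 2 powi i)"

lemma dyadic_value_gap:
  assumes "dyadic_value s" "dyadic_value t" "s < t"
  shows "2 * s \<le> t"
proof (cases "s = 0")
  case False
  then obtain i where i: "s = 2 powi i" using assms(1) by (auto simp: dyadic_value_def)
  then have "s > 0" by simp
  then obtain j where j: "t = 2 powi j" using assms by (auto simp: dyadic_value_def)
  have "i < j"
  proof (rule ccontr)
    assume "\<not> i < j"
    then have "t \<le> s" unfolding i j by (intro power_int_increasing) auto
    then show False using assms by simp
  qed
  then have "2 powi (i + 1) \<le> t" unfolding j by (intro power_int_increasing) auto
  then show ?thesis by (simp add: i power_int_add)
qed (use assms in auto)

lemma dyadic_value_double: "dyadic_value t \<Longrightarrow> dyadic_value (2 * t)"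
  unfolding dyadic_value_def
  by (metis mult_zero_right power_int_add_1' zero_neq_numeral)

definition dyadic_floor :: "real \<Rightarrow> real" where
  "dyadic_floor t = (if t \<le> 0 then 0 else 2 powi \<lfloor>log 2 t\<rfloor>)"

lemma dyadic_value_floor: "dyadic_value (dyadic_floor t)"
  by (auto simp: dyadic_value_def dyadic_floor_def)

lemma dyadic_floor_nonneg: "0 \<le> dyadic_floor t"
  by (simp add: dyadic_floor_def)

lemma dyadic_floor_mono: "s \<le> t \<Longrightarrow> dyadic_floor s \<le> dyadic_floor t"
  by (auto simp: dyadic_floor_def intro!: power_int_increasing floor_mono)

lemma dyadic_floor_bounds:
  assumes "0 \<le> t"
  shows "dyadic_floor t \<le> t" "t \<le> 2 * dyadic_floor t"
proof -
  have "dyadic_floor t \<le> t \<and> t \<le> 2 * dyadic_floor t"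
  proof (cases "t = 0")
    case False
    then have t: "t > 0" using assms by simp
    have *: "2 powi i = 2 powr real_of_int i" for i by (simp add: powr_real_of_int')
    have "2 powr real_of_int \<lfloor>log 2 t\<rfloor> \<le> 2 powr log 2 t" by (intro powr_mono) auto
    moreover have "2 powr log 2 t \<le> 2 powr (real_of_int \<lfloor>log 2 t\<rfloor> + 1)" by (intro powr_mono) linarith+
    ultimately show ?thesis using t by (simp add: dyadic_floor_def * powr_add)
  qed (simp add: dyadic_floor_def)
  then show "dyadic_floor t \<le> t" "t \<le> 2 * dyadic_floor t" by auto
qed

text \<open>\<open>\<phi> Q t\<close> models the integral of (t w)^p over E(Q); of the exponent only
  growth between degree 1 and degree \<open>P\<close> is kept. The assumption \<open>maximal\<close>
  is boundedness of \<open>M\<close> in unit-ball form: values dominated by the value on some larger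
  set remain controlled.\<close>

locale forest_modular =
  fixes S :: "'a set set" and \<phi> :: "'a set \<Rightarrow> real \<Rightarrow> real" and C P :: real
  assumes fin: "finite S"
    and nonempty: "\<And>Q. Q \<in> S \<Longrightarrow> Q \<noteq> {}"
    and laminar: "\<And>Q R. Q \<in> S \<Longrightarrow> R \<in> S \<Longrightarrow> Q \<inter> R = {} \<or> Q \<subseteq> R \<or> R \<subseteq> Q"
    and C_ge_1: "1 \<le> C" and P_ge_1: "1 \<le> P"
    and \<phi>_nonneg: "\<And>Q t. Q \<in> S \<Longrightarrow> 0 \<le> t \<Longrightarrow> 0 \<le> \<phi> Q t"
    and \<phi>_mono: "\<And>Q s t. Q \<in> S \<Longrightarrow> 0 \<le> s \<Longrightarrow> s \<le> t \<Longrightarrow> \<phi> Q s \<le> \<phi> Q t"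
    and \<phi>_shrink: "\<And>Q t c. Q \<in> S \<Longrightarrow> 0 \<le> t \<Longrightarrow> 0 \<le> c \<Longrightarrow> c \<le> 1 \<Longrightarrow> \<phi> Q (c * t) \<le> c * \<phi> Q t"
    and \<phi>_stretch: "\<And>Q t c. Q \<in> S \<Longrightarrow> 0 \<le> t \<Longrightarrow> 1 \<le> c \<Longrightarrow> \<phi> Q (c * t) \<le> c powr P * \<phi> Q t"
    and maximal: "\<And>\<alpha> \<gamma>. (\<And>Q. Q \<in> S \<Longrightarrow> 0 \<le> \<alpha> Q) \<Longrightarrow> (\<And>Q. Q \<in> S \<Longrightarrow> 0 \<le> \<gamma> Q) \<Longrightarrow>
        (\<And>R. R \<in> S \<Longrightarrow> \<exists>Q\<in>S. R \<subseteq> Q \<and> \<gamma> R \<le> \<alpha> Q) \<Longrightarrow>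
        (\<Sum>Q\<in>S. \<phi> Q (\<alpha> Q)) \<le> 1 \<Longrightarrow> (\<Sum>Q\<in>S. \<phi> Q (\<gamma> Q / C)) \<le> 1"
begin

text \<open>The shift U. The sets above \<open>R\<close> form a chain, and for a family that grows
  towards smaller sets the maximum is the value at the parent; a maximum spares the choice of a
  parent, and the inserted 0 serves the roots.\<close>

definition lift :: "('a set \<Rightarrow> real) \<Rightarrow> 'a set \<Rightarrow> real" where
  "lift \<gamma> R = Max (insert 0 (\<gamma> ` {Q \<in> S. R \<subset> Q}))"

definition admissible :: "('a set \<Rightarrow> real) \<Rightarrow> bool" where
  "admissible \<gamma> \<longleftrightarrow> (\<forall>Q\<in>S. dyadic_value (\<gamma> Q) \<and> 0 \<le> \<gamma> Q) \<and>
     (\<forall>Q\<in>S. \<forall>R\<in>S. R \<subseteq> Q \<longrightarrow> \<gamma> Q \<le> \<gamma> R)"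

definition \<Phi> :: "('a set \<Rightarrow> real) \<Rightarrow> real" where
  "\<Phi> \<gamma> = (\<Sum>Q\<in>S. \<phi> Q (\<gamma> Q))"

lemma fin_above: "finite (insert 0 (\<gamma> ` {Q \<in> S. R \<subset> Q}))"
  using fin by simp

lemma lift_nonneg: "0 \<le> lift \<gamma> R"
  unfolding lift_def by (rule Max_ge[OF fin_above]) simp

lemma lift_ge: "Q \<in> S \<Longrightarrow> R \<subset> Q \<Longrightarrow> \<gamma> Q \<le> lift \<gamma> R"
  unfolding lift_def by (rule Max_ge[OF fin_above]) auto

lemma lift_attained: "lift \<gamma> R = 0 \<or> (\<exists>Q\<in>S. R \<subset> Q \<and> lift \<gamma> R = \<gamma> Q)"
  using Max_in[OF fin_above, of \<gamma> R] unfolding lift_def by blast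

lemma lift_le: "admissible \<gamma> \<Longrightarrow> R \<in> S \<Longrightarrow> lift \<gamma> R \<le> \<gamma> R"
  using lift_attained[of \<gamma> R] unfolding admissible_def by (metis psubset_imp_subset)

lemma lift_double: "lift (\<lambda>Q. 2 * \<gamma> Q) R = 2 * lift \<gamma> R"
proof -
  have "mono (\<lambda>x::real. 2 * x)" by (auto simp: mono_def)
  from mono_Max_commute[OF this fin_above, of \<gamma> R] show ?thesis
    unfolding lift_def by (simp add: image_image)
qed

lemma admissible_lift: "admissible \<gamma> \<Longrightarrow> admissible (lift \<gamma>)"
  unfolding admissible_def
proof (intro conjI ballI impI)
  fix Q assume *: "(\<forall>Q\<in>S. dyadic_value (\<gamma> Q) \<and> 0 \<le> \<gamma> Q) \<and> (\<forall>Q\<in>S. \<forall>R\<in>S. R \<subseteq> Q \<longrightarrow> \<gamma> Q \<le> \<gamma> R)" "Q \<in> S"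
  show "dyadic_value (lift \<gamma> Q)"
  proof (cases "lift \<gamma> Q = 0")
    case False
    then obtain R where "R \<in> S" "lift \<gamma> Q = \<gamma> R" using lift_attained[of \<gamma> Q] by blast
    then show ?thesis using conjunct1[OF *(1)] by metis
  qed (simp add: dyadic_value_def)
  show "0 \<le> lift \<gamma> Q" by (rule lift_nonneg)
  fix R assume "R \<in> S" "R \<subseteq> Q"
  then show "lift \<gamma> Q \<le> lift \<gamma> R" using lift_attained[of \<gamma> Q] lift_ge[of _ R \<gamma>] lift_nonneg[of \<gamma> R]
    by (metis subset_psubset_trans)
qed

lemma admissible_double: "admissible \<gamma> \<Longrightarrow> admissible (\<lambda>Q. 2 * \<gamma> Q)"
  unfolding admissible_def by (auto intro: dyadic_value_double)

lemma admissible_funpow: "admissible \<gamma> \<Longrightarrow> admissible ((lift ^^ j) \<gamma>)"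
  by (induction j) (auto intro: admissible_lift)

lemma admissible_nonneg: "admissible \<gamma> \<Longrightarrow> Q \<in> S \<Longrightarrow> 0 \<le> \<gamma> Q"
  by (auto simp: admissible_def)

lemma \<Phi>_mono: "(\<And>Q. Q \<in> S \<Longrightarrow> 0 \<le> \<beta> Q \<and> \<beta> Q \<le> \<gamma> Q) \<Longrightarrow> \<Phi> \<beta> \<le> \<Phi> \<gamma>"
  unfolding \<Phi>_def by (intro sum_mono \<phi>_mono) auto

lemma \<Phi>_nonneg: "(\<And>Q. Q \<in> S \<Longrightarrow> 0 \<le> \<beta> Q) \<Longrightarrow> 0 \<le> \<Phi> \<beta>"
  unfolding \<Phi>_def by (intro sum_nonneg \<phi>_nonneg) auto

lemma \<Phi>_shrink:
  "(\<And>Q. Q \<in> S \<Longrightarrow> 0 \<le> \<beta> Q) \<Longrightarrow> 0 \<le> c \<Longrightarrow> c \<le> 1 \<Longrightarrow> \<Phi> (\<lambda>Q. c * \<beta> Q) \<le> c * \<Phi> \<beta>"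
  unfolding \<Phi>_def sum_distrib_left by (intro sum_mono \<phi>_shrink) auto

lemma \<Phi>_stretch:
  "(\<And>Q. Q \<in> S \<Longrightarrow> 0 \<le> \<beta> Q) \<Longrightarrow> 1 \<le> c \<Longrightarrow> \<Phi> (\<lambda>Q. c * \<beta> Q) \<le> c powr P * \<Phi> \<beta>"
  unfolding \<Phi>_def sum_distrib_left by (intro sum_mono \<phi>_stretch) auto

text \<open>A family of modular at most \<open>\<delta>\<close> stays in the unit ball after
  multiplication by \<open>C * 2 powr P\<close>: the factor \<open>C\<close> pays for
  \<open>maximal\<close>, the factor \<open>2 powr P\<close> for the threshold in
  \<open>lift_loss\<close>.\<close>

definition \<delta> :: real where "\<delta> = inverse ((C * 2 powr P) powr P)"
text \<open>More than \<open>2 / \<delta>\<close> losses of \<open>\<delta> / 2\<close> would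
  exhaust a modular of 1. The number depends on \<open>C\<close> and \<open>P\<close> but not on
  \<open>S\<close>.\<close>

definition decay_steps :: nat where "decay_steps = Suc (nat \<lceil>2 / \<delta>\<rceil>)"

lemma \<delta>_pos: "\<delta> > 0"
  using C_ge_1 by (simp add: \<delta>_def)

text \<open>The mass lost in one lifting step sits where the value strictly drops, and the values at these
  places already generate \<^term>\<open>\<mu>\<close> by taking maxima over larger sets.\<close>

lemma lift_loss:
  assumes adm: "admissible \<mu>" and large: "\<Phi> \<mu> > 2 powr (-P)"
  shows "\<Phi> (lift \<mu>) \<le> \<Phi> \<mu> - \<delta> / 2"
proof -
  define \<kappa> where "\<kappa> Q = (if lift \<mu> Q < \<mu> Q then \<mu> Q else 0)" for Q
  define c where "c = C * 2 powr P"
  have c1: "1 \<le> c" unfolding c_def using C_ge_1 P_ge_1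
    by (metis ge_one_powr_ge_zero mult_mono mult_1 one_le_numeral order.trans zero_le_one)
  have \<mu>0: "\<And>Q. Q \<in> S \<Longrightarrow> 0 \<le> \<mu> Q" using adm by (rule admissible_nonneg)
  have \<kappa>0: "\<And>Q. Q \<in> S \<Longrightarrow> 0 \<le> \<kappa> Q" using \<mu>0 by (auto simp: \<kappa>_def)
  have gen: "\<exists>Q\<in>S. R \<subseteq> Q \<and> \<mu> R \<le> \<kappa> Q" if R: "R \<in> S" for R
  proof (cases "\<mu> R = 0")
    case True
    then show ?thesis using R \<kappa>0 by force
  next
    case False
    \<comment> \<open>Climb from \<open>R\<close> through the sets that carry the same value. At a
      largest one the value must drop under lifting, since otherwise a still larger set would attain
      it.\<close>
    let ?A = "{Q \<in> S. R \<subseteq> Q \<and> \<mu> Q = \<mu> R}"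
    have "finite ?A" "?A \<noteq> {}" using fin R by auto
    then obtain Q where Q: "Q \<in> ?A" and Qmax: "\<And>Q'. Q' \<in> ?A \<Longrightarrow> Q \<subseteq> Q' \<Longrightarrow> Q = Q'"
      using finite_has_maximal[of ?A] by blast
    have "lift \<mu> Q \<noteq> \<mu> Q"
    proof
      assume eq: "lift \<mu> Q = \<mu> Q"
      then obtain Q' where "Q' \<in> S" "Q \<subset> Q'" "\<mu> Q' = \<mu> R"
      proof -
        have "lift \<mu> Q \<noteq> 0" "\<mu> Q = \<mu> R" using eq False Q by auto
        then show ?thesis using lift_attained[of \<mu> Q] eq that by metis
      qed
      then show False using Qmax[of Q'] Q by blast
    qed
    then have "lift \<mu> Q < \<mu> Q" using lift_le[OF adm, of Q] Q by auto
    then show ?thesis using Q by (intro bexI[of _ Q]) (auto simp: \<kappa>_def)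
  qed
  have "\<delta> < \<Phi> \<kappa>"
  proof (rule ccontr)
    \<comment> \<open>Then \<open>c * \<kappa>\<close> is in the unit ball, \<open>maximal\<close>
      puts \<open>2 powr P * \<mu>\<close> there as well, and shrinking back contradicts
      \<open>large\<close>.\<close>
    assume "\<not> \<delta> < \<Phi> \<kappa>"
    then have "c powr P * \<Phi> \<kappa> \<le> c powr P * \<delta>" by (intro mult_left_mono) auto
    also have "\<dots> = 1" using C_ge_1 by (simp add: \<delta>_def c_def)
    finally have "\<Phi> (\<lambda>Q. c * \<kappa> Q) \<le> 1" using \<Phi>_stretch[of \<kappa> c] \<kappa>0 c1 by simp
    then have "(\<Sum>Q\<in>S. \<phi> Q (c * \<mu> Q / C)) \<le> 1"
    proof (intro maximal[of "\<lambda>Q. c * \<kappa> Q"])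
      show "\<exists>Q\<in>S. R \<subseteq> Q \<and> c * \<mu> R \<le> c * \<kappa> Q" if "R \<in> S" for R
        using gen[OF that] c1 by (metis mult_left_mono order.trans zero_le_one)
    qed (use \<kappa>0 \<mu>0 c1 in \<open>auto simp: \<Phi>_def\<close>)
    then have *: "\<Phi> (\<lambda>Q. 2 powr P * \<mu> Q) \<le> 1" using C_ge_1 by (simp add: \<Phi>_def c_def)
    have "\<Phi> \<mu> = \<Phi> (\<lambda>Q. 2 powr (-P) * (2 powr P * \<mu> Q))"
      by (simp add: mult.assoc[symmetric] powr_minus)
    also have "\<dots> \<le> 2 powr (-P) * \<Phi> (\<lambda>Q. 2 powr P * \<mu> Q)"
    proof (intro \<Phi>_shrink)
      show "2 powr (-P) \<le> 1" using P_ge_1 powr_mono[of "-P" 0 2] by simp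
    qed (use \<mu>0 in auto)
    also have "\<dots> \<le> 2 powr (-P)" using * by (simp add: mult_left_le)
    finally show False using large by simp
  qed
  moreover have "\<Phi> (lift \<mu>) \<le> \<Phi> \<mu> - \<Phi> \<kappa> / 2"
  proof -
    have "\<phi> Q (lift \<mu> Q) \<le> \<phi> Q (\<mu> Q) - \<phi> Q (\<kappa> Q) / 2" if Q: "Q \<in> S" for Q
    proof (cases "lift \<mu> Q < \<mu> Q")
      case True
      \<comment> \<open>Both values are dyadic, so a strict drop is at least a halving.\<close>
      then have "2 * lift \<mu> Q \<le> \<mu> Q"
        using adm admissible_lift[OF adm] Q by (intro dyadic_value_gap) (auto simp: admissible_def)
      then have "\<phi> Q (lift \<mu> Q) \<le> \<phi> Q (1/2 * \<mu> Q)"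
        using lift_nonneg Q by (intro \<phi>_mono) auto
      also have "\<dots> \<le> 1/2 * \<phi> Q (\<mu> Q)" using Q \<mu>0 by (intro \<phi>_shrink) auto
      finally show ?thesis using True by (simp add: \<kappa>_def)
    next
      case False
      \<comment> \<open>Shrinking by the factor 0: sets without a drop add nothing positive to
        \<open>\<Phi> \<kappa>\<close>.\<close>
      have "\<phi> Q 0 \<le> 0" using \<phi>_shrink[OF Q, of 0 0] by simp
      moreover have "\<phi> Q (lift \<mu> Q) \<le> \<phi> Q (\<mu> Q)"
        using lift_nonneg lift_le[OF adm Q] Q by (intro \<phi>_mono) auto
      ultimately show ?thesis using False by (simp add: \<kappa>_def)
    qed
    then have "\<Phi> (lift \<mu>) \<le> (\<Sum>Q\<in>S. \<phi> Q (\<mu> Q) - \<phi> Q (\<kappa> Q) / 2)"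
      unfolding \<Phi>_def by (rule sum_mono)
    then show ?thesis by (simp add: \<Phi>_def sum_subtractf sum_divide_distrib)
  qed
  ultimately show ?thesis by simp
qed

lemma funpow_lift_le:
  assumes "admissible \<gamma>" "Q \<in> S" "i \<le> j"
  shows "(lift ^^ j) \<gamma> Q \<le> (lift ^^ i) \<gamma> Q"
  using assms(3)
proof (induction rule: dec_induct)
  case (step n)
  then show ?case using lift_le[OF admissible_funpow[OF assms(1)] assms(2), of n] by simp
qed simp

text \<open>Above the threshold \<open>2 powr (-P)\<close> every step loses
  \<open>\<delta> / 2\<close>, and there are too many steps for a modular of at most 1. Once below
  the threshold, doubling the family costs at most the factor \<open>2 powr P\<close>. A loss of
  modular thus becomes a halving of the norm.\<close>

lemma lift_decay:
  assumes adm: "admissible \<gamma>" and le: "\<Phi> \<gamma> \<le> 1"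
  shows "\<Phi> (\<lambda>Q. 2 * (lift ^^ decay_steps) \<gamma> Q) \<le> 1"
proof -
  let ?\<gamma> = "\<lambda>j. (lift ^^ j) \<gamma>"
  have adm': "admissible (?\<gamma> j)" for j using adm by (rule admissible_funpow)
  have "\<Phi> (?\<gamma> decay_steps) \<le> 2 powr (-P)"
  proof (rule ccontr)
    assume neg: "\<not> ?thesis"
    have large: "\<Phi> (?\<gamma> j) > 2 powr (-P)" if "j \<le> decay_steps" for j
    proof -
      have "\<Phi> (?\<gamma> decay_steps) \<le> \<Phi> (?\<gamma> j)"
        using funpow_lift_le[OF adm _ that] admissible_nonneg[OF adm'] by (intro \<Phi>_mono) auto
      then show ?thesis using neg by simp
    qed
    have "j \<le> decay_steps \<Longrightarrow> \<Phi> (?\<gamma> j) \<le> 1 - real j * \<delta> / 2" for j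
    proof (induction j)
      case (Suc j)
      then show ?case using lift_loss[OF adm' large, of j] by (simp add: field_simps)
    qed (use le in simp)
    from this[of decay_steps] have "real decay_steps * \<delta> / 2 \<le> 1"
      using \<Phi>_nonneg[of "?\<gamma> decay_steps"] admissible_nonneg[OF adm'] by force
    moreover have "real decay_steps > 2 / \<delta>" unfolding decay_steps_def by linarith
    then have "real decay_steps * \<delta> > 2" using \<delta>_pos by (simp add: field_simps)
    ultimately show False by simp
  qed
  then have "2 powr P * \<Phi> (?\<gamma> decay_steps) \<le> 2 powr P * 2 powr (-P)" by (intro mult_left_mono) auto
  also have "\<dots> = 1" by (simp add: powr_minus)
  finally show ?thesis using \<Phi>_stretch[of "?\<gamma> decay_steps" 2] admissible_nonneg[OF adm'] by force
qed

lemma funpow_lift_double: "(lift ^^ j) (\<lambda>Q. 2 * \<gamma> Q) = (\<lambda>Q. 2 * (lift ^^ j) \<gamma> Q)"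
  by (induction j) (auto simp: lift_double)

text \<open>Twice the shifted family is again admissible and in the unit ball, so the decay restarts
  from it; lifting commutes with doubling.\<close>

lemma lift_decay_iterate:
  assumes "admissible \<gamma>" "\<Phi> \<gamma> \<le> 1"
  shows "\<Phi> (\<lambda>Q. 2 ^ m * (lift ^^ (m * decay_steps)) \<gamma> Q) \<le> 1"
  using assms
proof (induction m arbitrary: \<gamma>)
  case (Suc m)
  have "\<Phi> (\<lambda>Q. 2 ^ m * (lift ^^ (m * decay_steps)) (\<lambda>Q. 2 * (lift ^^ decay_steps) \<gamma> Q) Q) \<le> 1"
    using Suc by (intro Suc.IH lift_decay admissible_double admissible_funpow)
  then show ?case
    by (simp add: funpow_lift_double funpow_add[symmetric, THEN fun_cong, unfolded o_def] add.commute mult_ac)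
qed simp

text \<open>The j-th shift at \<open>R\<close> is at least the value on the j-th ancestor of
  \<open>R\<close>; beyond the root it is merely non-negative. The induction passes to the least
  strict superset \<open>Q1\<close>, which exists because the sets above \<open>R\<close> form a
  chain.\<close>

lemma sum_above_le:
  assumes "admissible \<gamma>" "R \<in> S" "card {Q \<in> S. R \<subset> Q} < n"
  shows "(\<Sum>Q | Q \<in> S \<and> R \<subseteq> Q. \<gamma> Q) \<le> (\<Sum>j<n. (lift ^^ j) \<gamma> R)"
  using assms(2,3)
proof (induction n arbitrary: R)
  case (Suc n)
  let ?A = "{Q \<in> S. R \<subset> Q}"
  have finA: "finite ?A" using fin by simp
  have nn: "0 \<le> (lift ^^ j) \<gamma> Q" if "Q \<in> S" for j Q
    using that admissible_nonneg[OF admissible_funpow[OF assms(1)]] by blast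
  have split: "{Q. Q \<in> S \<and> R \<subseteq> Q} = insert R ?A" using Suc.prems by auto
  have eq: "(\<Sum>Q | Q \<in> S \<and> R \<subseteq> Q. \<gamma> Q) = \<gamma> R + (\<Sum>Q\<in>?A. \<gamma> Q)"
    unfolding split using finA by (subst sum.insert) auto
  have eq': "(\<Sum>j<Suc n. (lift ^^ j) \<gamma> R) = \<gamma> R + (\<Sum>j<n. (lift ^^ Suc j) \<gamma> R)"
    by (subst sum.lessThan_Suc_shift) simp
  show ?case
  proof (cases "?A = {}")
    case True
    have "0 \<le> (\<Sum>j<n. (lift ^^ Suc j) \<gamma> R)" using nn[OF Suc.prems(1)] by (intro sum_nonneg) blast
    moreover have "(\<Sum>Q\<in>?A. \<gamma> Q) = 0" by (simp only: True sum.empty)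
    ultimately show ?thesis using eq eq' by linarith
  next
    case False
    obtain Q1 where Q1: "Q1 \<in> ?A" and "\<forall>Q\<in>?A. Q \<subseteq> Q1 \<longrightarrow> Q1 = Q"
      using finite_has_minimal[OF finA False] by (rule bexE)
    then have min: "\<And>Q. Q \<in> ?A \<Longrightarrow> Q \<subseteq> Q1 \<Longrightarrow> Q1 = Q" by simp
    have above: "Q1 \<subseteq> Q" if "Q \<in> ?A" for Q
    proof -
      have "Q \<inter> Q1 \<noteq> {}" using that Q1 nonempty[OF Suc.prems(1)] by blast
      then show ?thesis using laminar[of Q Q1] that Q1 min[OF that] by auto
    qed
    have A: "?A = {Q. Q \<in> S \<and> Q1 \<subseteq> Q}" using above Q1 by auto
    have "card {Q \<in> S. Q1 \<subset> Q} < card ?A" using Q1 by (intro psubset_card_mono[OF finA]) auto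
    then have "card {Q \<in> S. Q1 \<subset> Q} < n" using Suc.prems(2) by linarith
    then have "(\<Sum>Q\<in>?A. \<gamma> Q) \<le> (\<Sum>j<n. (lift ^^ j) \<gamma> Q1)"
      unfolding A using Q1 by (intro Suc.IH) auto
    also have "\<dots> \<le> (\<Sum>j<n. (lift ^^ Suc j) \<gamma> R)"
      using Q1 by (intro sum_mono) (auto intro: lift_ge)
    finally show ?thesis using eq eq' by linarith
  qed
qed simp

lemma sum_geometric_blocks: "0 < k \<Longrightarrow> (\<Sum>j<n. (1/2::real) ^ (j div k)) \<le> 2 * real k"
proof -
  assume k: "0 < k"
  have block: "(\<Sum>j=m * k..<m * k + k. (1/2::real) ^ (j div k)) = real k * (1/2) ^ m" for m
  proof -
    have "(\<Sum>j=m * k..<m * k + k. (1/2::real) ^ (j div k)) = (\<Sum>j=m * k..<m * k + k. (1/2) ^ m)"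
    proof (intro sum.cong refl)
      fix j assume "j \<in> {m * k..<m * k + k}"
      then have "j div k = m" by (intro div_nat_eqI) (auto simp: mult.commute)
      then show "(1/2::real) ^ (j div k) = (1/2) ^ m" by simp
    qed
    then show ?thesis by simp
  qed
  have "(\<Sum>j<n. (1/2::real) ^ (j div k)) \<le> (\<Sum>j<n * k. (1/2) ^ (j div k))"
    using k by (intro sum_mono2) (auto intro: order.strict_trans2)
  also have "\<dots> = real k * (\<Sum>i<n. (1/2) ^ i)" 
    unfolding sum.nat_group[symmetric] block sum_distrib_left ..
  also have "(\<Sum>i<n. (1/2::real) ^ i) \<le> 2" by (simp add: sum_gp_strict)
  finally show ?thesis using k by (simp add: mult_left_mono mult.commute)
qed

text \<open>\<open>pairing\<close> bounds \<psi> as a functional on coefficients over the sets E(Q);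
  the conclusion replaces E(Q) by all of Q. Exchanging the sums turns sums below \<open>Q\<close>
  into sums above \<open>R\<close>, which the shifts dominate. In the constant, \<open>2 * C\<close>
  comes from the running maximum and the rounding, 2 from \<open>pairing\<close>, and
  \<open>2 * decay_steps\<close> from a geometric series that is constant on blocks.\<close>

theorem carleson_bound:
  assumes \<psi>0: "\<And>Q. Q \<in> S \<Longrightarrow> 0 \<le> \<psi> Q"
    and pairing: "\<And>\<alpha>. (\<And>Q. Q \<in> S \<Longrightarrow> 0 \<le> \<alpha> Q) \<Longrightarrow> \<Phi> \<alpha> \<le> 1 \<Longrightarrow> (\<Sum>Q\<in>S. \<psi> Q * \<alpha> Q) \<le> 2"
    and \<alpha>0: "\<And>Q. Q \<in> S \<Longrightarrow> 0 \<le> \<alpha> Q" and \<alpha>1: "\<Phi> \<alpha> \<le> 1"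
  shows "(\<Sum>Q\<in>S. \<alpha> Q * (\<Sum>R | R \<in> S \<and> R \<subseteq> Q. \<psi> R)) \<le> 8 * C * real decay_steps"
proof -
  define \<gamma>0 where "\<gamma>0 R = Max (\<alpha> ` {Q \<in> S. R \<subseteq> Q})" for R
  define \<gamma> where "\<gamma> R = dyadic_floor (\<gamma>0 R / C)" for R
  have finA: "finite (\<alpha> ` {Q \<in> S. R \<subseteq> Q})" for R using fin by simp
  have attained: "\<exists>Q\<in>S. R \<subseteq> Q \<and> \<gamma>0 R = \<alpha> Q" if "R \<in> S" for R
    using Max_in[OF finA, of R] that unfolding \<gamma>0_def by blast
  have \<gamma>0_ge: "\<alpha> Q \<le> \<gamma>0 R" if "Q \<in> S" "R \<subseteq> Q" for Q R
    unfolding \<gamma>0_def using that by (intro Max_ge[OF finA]) auto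
  have \<gamma>0_nonneg: "0 \<le> \<gamma>0 R" if "R \<in> S" for R using attained[OF that] \<alpha>0 by auto
  have "\<Phi> (\<lambda>R. \<gamma>0 R / C) \<le> 1"
    unfolding \<Phi>_def
  proof (rule maximal[of \<alpha>])
    show "\<exists>Q\<in>S. R \<subseteq> Q \<and> \<gamma>0 R \<le> \<alpha> Q" if "R \<in> S" for R using attained[OF that] by auto
  qed (use \<alpha>0 \<alpha>1 \<gamma>0_nonneg in \<open>auto simp: \<Phi>_def\<close>)
  moreover have "\<Phi> \<gamma> \<le> \<Phi> (\<lambda>R. \<gamma>0 R / C)"
    using \<gamma>0_nonneg C_ge_1 unfolding \<gamma>_def
    by (intro \<Phi>_mono conjI dyadic_floor_nonneg dyadic_floor_bounds) auto
  ultimately have \<gamma>1: "\<Phi> \<gamma> \<le> 1" by simp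
  have adm: "admissible \<gamma>"
    unfolding admissible_def
  proof (intro conjI ballI impI)
    fix Q R assume "Q \<in> S" "R \<in> S" "R \<subseteq> Q"
    then have "\<gamma>0 Q \<le> \<gamma>0 R" using attained[of Q] \<gamma>0_ge[of _ R] by force
    then show "\<gamma> Q \<le> \<gamma> R" unfolding \<gamma>_def using C_ge_1
      by (intro dyadic_floor_mono divide_right_mono) auto
  qed (auto simp: \<gamma>_def dyadic_value_floor dyadic_floor_nonneg)
  have \<alpha>_le: "\<alpha> Q \<le> 2 * C * \<gamma> Q" if "Q \<in> S" for Q
  proof -
    have "\<gamma>0 Q / C \<le> 2 * \<gamma> Q"
      unfolding \<gamma>_def using \<gamma>0_nonneg[OF that] C_ge_1 by (intro dyadic_floor_bounds) auto
    then show ?thesis using \<gamma>0_ge[OF that, of Q] C_ge_1 by (simp add: field_simps)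
  qed
  define n where "n = Suc (card S)"
  have J0: "0 < decay_steps" by (simp add: decay_steps_def)
  \<comment> \<open>Decay is known at multiples of \<open>decay_steps\<close> only; in between, the
    shifts decrease.\<close>
  have level: "(\<Sum>R\<in>S. \<psi> R * (lift ^^ j) \<gamma> R) \<le> 2 * (1/2) ^ (j div decay_steps)" for j
  proof -
    let ?m = "j div decay_steps"
    have "\<Phi> (\<lambda>R. 2 ^ ?m * (lift ^^ j) \<gamma> R) \<le> \<Phi> (\<lambda>R. 2 ^ ?m * (lift ^^ (?m * decay_steps)) \<gamma> R)"
      using funpow_lift_le[OF adm] admissible_nonneg[OF admissible_funpow[OF adm]]
      by (intro \<Phi>_mono) auto
    also have "\<dots> \<le> 1" by (rule lift_decay_iterate[OF adm \<gamma>1])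
    finally have "(\<Sum>R\<in>S. \<psi> R * (2 ^ ?m * (lift ^^ j) \<gamma> R)) \<le> 2"
      using admissible_nonneg[OF admissible_funpow[OF adm]] by (intro pairing) auto
    also have "(\<Sum>R\<in>S. \<psi> R * (2 ^ ?m * (lift ^^ j) \<gamma> R)) = 2 ^ ?m * (\<Sum>R\<in>S. \<psi> R * (lift ^^ j) \<gamma> R)"
      by (simp add: sum_distrib_left mult_ac)
    finally show ?thesis by (simp add: field_simps power_divide)
  qed
  have "(\<Sum>Q\<in>S. \<alpha> Q * (\<Sum>R | R \<in> S \<and> R \<subseteq> Q. \<psi> R)) = (\<Sum>R\<in>S. \<psi> R * (\<Sum>Q | Q \<in> S \<and> R \<subseteq> Q. \<alpha> Q))"
    unfolding sum_distrib_left using fin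
    by (subst sum.swap_restrict) (auto simp: mult.commute intro!: sum.cong)
  also have "\<dots> \<le> (\<Sum>R\<in>S. \<psi> R * (2 * C * (\<Sum>j<n. (lift ^^ j) \<gamma> R)))"
  proof (intro sum_mono mult_left_mono \<psi>0)
    fix R assume R: "R \<in> S"
    have "(\<Sum>Q | Q \<in> S \<and> R \<subseteq> Q. \<alpha> Q) \<le> 2 * C * (\<Sum>Q | Q \<in> S \<and> R \<subseteq> Q. \<gamma> Q)"
      unfolding sum_distrib_left by (intro sum_mono \<alpha>_le) auto
    also have "\<dots> \<le> 2 * C * (\<Sum>j<n. (lift ^^ j) \<gamma> R)"
      using C_ge_1 card_mono[of S "{Q \<in> S. R \<subset> Q}"] fin
      by (intro mult_left_mono sum_above_le[OF adm R]) (auto simp: n_def)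
    finally show "(\<Sum>Q | Q \<in> S \<and> R \<subseteq> Q. \<alpha> Q) \<le> 2 * C * (\<Sum>j<n. (lift ^^ j) \<gamma> R)" .
  qed
  also have "\<dots> = 2 * C * (\<Sum>j<n. \<Sum>R\<in>S. \<psi> R * (lift ^^ j) \<gamma> R)"
    by (subst sum.swap) (simp add: sum_distrib_left mult_ac)
  also have "\<dots> \<le> 2 * C * (\<Sum>j<n. 2 * (1/2) ^ (j div decay_steps))"
    using C_ge_1 by (intro mult_left_mono sum_mono level) auto
  also have "\<dots> \<le> 2 * C * (2 * (2 * real decay_steps))"
    unfolding sum_distrib_left[symmetric]
    using C_ge_1 sum_geometric_blocks[OF J0, of n] by (intro mult_left_mono) auto
  finally show ?thesis by simp
qed

end

section \<open>Laminar families and cubes\<close>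

text \<open>Young's inequality without its factors 1/p and 1/p'. Comparing b with a^(p-1), the curve
  where the two terms agree, shows that the product is below one of them.\<close>

lemma powr_young:
  fixes a b p :: real
  assumes "0 \<le> a" "0 \<le> b" "1 < p"
  shows "a * b \<le> a powr p + b powr (p / (p - 1))"
proof (cases "b \<le> a powr (p - 1)")
  case True
  then have "a * b \<le> a * a powr (p - 1)" using assms by (intro mult_left_mono) auto
  also have "\<dots> = a powr p" using assms by (cases "a = 0") (simp_all add: powr_mult_base)
  finally show ?thesis by (simp add: add_increasing2)
next
  case False
  have b: "0 < b" using False by (metis linorder_not_le order.strict_trans1 powr_ge_zero)
  have "a = (a powr (p - 1)) powr (1 / (p - 1))" using assms by (simp add: powr_powr)
  also have "\<dots> \<le> b powr (1 / (p - 1))" using False assms by (intro powr_mono2) auto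
  finally have "a * b \<le> b powr (1 / (p - 1)) * b" using b by (intro mult_right_mono) auto
  also have "\<dots> = b powr (1 / (p - 1) + 1)" using b by (simp add: powr_add)
  also have "1 / (p - 1) + 1 = p / (p - 1)" using assms by (simp add: field_simps)
  finally show ?thesis by (simp add: add_increasing)
qed

section \<open>The sets E(Q) as disjoint cores of a laminar family, and step functions on
  them\<close>

definition core :: "'a set set \<Rightarrow> 'a set \<Rightarrow> 'a set" where
  "core S Q = Q - \<Union>{R \<in> S. R \<subset> Q}"

definition step :: "'a set set \<Rightarrow> ('a set \<Rightarrow> real) \<Rightarrow> 'a \<Rightarrow> real" where
  "step S \<alpha> x = (\<Sum>Q\<in>S. \<alpha> Q * indicator (core S Q) x)"

definition laminar :: "'a set set \<Rightarrow> bool" where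
  "laminar S \<longleftrightarrow> (\<forall>Q\<in>S. \<forall>R\<in>S. Q \<inter> R = {} \<or> Q \<subseteq> R \<or> R \<subseteq> Q)"

lemma laminar_subset: "laminar S \<Longrightarrow> T \<subseteq> S \<Longrightarrow> laminar T"
  unfolding laminar_def by blast

lemma core_subset: "core S Q \<subseteq> Q"
  by (auto simp: core_def)

lemma core_disjoint:
  assumes "laminar S" "Q \<in> S" "R \<in> S" "x \<in> core S Q" "x \<in> core S R"
  shows "Q = R"
proof -
  have x: "x \<in> Q" "x \<in> R" using assms(4,5) by (auto simp: core_def)
  have "Q \<inter> R = {} \<or> Q \<subseteq> R \<or> R \<subseteq> Q" using assms(1-3) by (simp add: laminar_def)
  then have "Q \<subseteq> R \<or> R \<subseteq> Q" using x by blast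
  moreover have "\<not> Q \<subset> R" using assms(2,5) x(1) by (auto simp: core_def)
  moreover have "\<not> R \<subset> Q" using assms(3,4) x(2) by (auto simp: core_def)
  ultimately show ?thesis by blast
qed

lemma core_exists:
  assumes "finite S" "laminar S" "Q \<in> S" "x \<in> Q"
  obtains R where "R \<in> S" "x \<in> core S R" "\<And>Q. Q \<in> S \<Longrightarrow> x \<in> Q \<Longrightarrow> R \<subseteq> Q"
proof -
  let ?A = "{R \<in> S. x \<in> R}"
  have "finite ?A" "?A \<noteq> {}" using assms by auto
  from finite_has_minimal[OF this] obtain R where R: "R \<in> ?A" "\<forall>Q\<in>?A. Q \<subseteq> R \<longrightarrow> R = Q" by (rule bexE)
  show ?thesis
  proof (rule that)
    show "R \<in> S" using R(1) by simp
    have "x \<notin> T" if "T \<in> S" "T \<subset> R" for T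
    proof
      assume "x \<in> T"
      then have "R = T" using bspec[OF R(2), of T] that by auto
      then show False using that by simp
    qed
    then show "x \<in> core S R" using R(1) by (auto simp: core_def)
    show "R \<subseteq> Q" if Q: "Q \<in> S" "x \<in> Q" for Q
    proof -
      have "R \<inter> Q = {} \<or> R \<subseteq> Q \<or> Q \<subseteq> R" using assms(2) R(1) Q(1) by (simp add: laminar_def)
      then show ?thesis using bspec[OF R(2), of Q] R(1) Q by auto
    qed
  qed
qed

lemma indicator_core:
  assumes "laminar S" "Q \<in> S" "R \<in> S" "x \<in> core S Q"
  shows "indicator (core S R) x = (if R = Q then 1 else 0)"
proof (cases "R = Q")
  case False
  then have "x \<notin> core S R" using core_disjoint[OF assms(1-4)] by blast
  then show ?thesis using False by simp
qed (use assms(4) in simp)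

lemma step_core:
  assumes "finite S" "laminar S" "Q \<in> S" "x \<in> core S Q"
  shows "step S \<alpha> x = \<alpha> Q"
proof -
  have "step S \<alpha> x = (\<Sum>R\<in>S. if R = Q then \<alpha> Q else 0)"
    unfolding step_def by (intro sum.cong) (simp_all add: indicator_core[OF assms(2,3) _ assms(4)])
  then show ?thesis using assms by simp
qed

lemma step_outside: "(\<And>Q. Q \<in> S \<Longrightarrow> x \<notin> core S Q) \<Longrightarrow> step S \<alpha> x = 0"
  by (simp add: step_def)

lemma step_nonneg: "(\<And>Q. Q \<in> S \<Longrightarrow> 0 \<le> \<alpha> Q) \<Longrightarrow> 0 \<le> step S \<alpha> x"
  unfolding step_def by (intro sum_nonneg) auto

lemma core_sets:
  assumes "finite S" "S \<subseteq> sets M" "Q \<in> S"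
  shows "core S Q \<in> sets M"
  unfolding core_def using assms by (intro sets.Diff sets.finite_Union) auto

lemma step_measurable [measurable]:
  assumes "finite S" "S \<subseteq> sets M"
  shows "step S \<alpha> \<in> borel_measurable M"
  unfolding step_def[abs_def] using core_sets[OF assms]
  by (intro borel_measurable_sum borel_measurable_times borel_measurable_indicator) auto

text \<open>At most one core contains a given point, so even a nonlinear \<open>G\<close> may be
  applied term by term; \<open>G 0 x = 0\<close> handles the points outside all cores.\<close>

lemma nn_integral_step:
  fixes G :: "real \<Rightarrow> 'a \<Rightarrow> ennreal"
  assumes "finite S" "laminar S" "S \<subseteq> sets M"
    and "\<And>Q. Q \<in> S \<Longrightarrow> G (\<alpha> Q) \<in> borel_measurable M"
    and "\<And>x. G 0 x = 0"
  shows "(\<integral>\<^sup>+x. G (step S \<alpha> x) x \<partial>M) = (\<Sum>Q\<in>S. \<integral>\<^sup>+x\<in>core S Q. G (\<alpha> Q) x \<partial>M)"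
proof -
  have "G (step S \<alpha> x) x = (\<Sum>Q\<in>S. G (\<alpha> Q) x * indicator (core S Q) x)" for x
  proof (cases "\<exists>Q\<in>S. x \<in> core S Q")
    case True
    then obtain Q where Q: "Q \<in> S" "x \<in> core S Q" by blast
    have "(\<Sum>R\<in>S. G (\<alpha> R) x * indicator (core S R) x) = (\<Sum>R\<in>S. if R = Q then G (\<alpha> Q) x else 0)"
      by (intro sum.cong) (simp_all add: indicator_core[OF assms(2) Q(1) _ Q(2)])
    then show ?thesis using Q assms(1) step_core[OF assms(1,2) Q] by simp
  next
    case False
    then show ?thesis using step_outside[of S x] assms(5) by auto
  qed
  then show ?thesis
    using core_sets[OF assms(1,3)] assms(4) by (simp add: nn_integral_sum)
qed

lemma nn_integral_cores_below:
  assumes "finite S" "laminar S" "S \<subseteq> sets M" "Q \<in> S" "g \<in> borel_measurable M"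
  shows "(\<integral>\<^sup>+x\<in>Q. g x \<partial>M) = (\<Sum>R | R \<in> S \<and> R \<subseteq> Q. \<integral>\<^sup>+x\<in>core S R. g x \<partial>M)"
proof -
  have "g x * indicator Q x = (\<Sum>R | R \<in> S \<and> R \<subseteq> Q. g x * indicator (core S R) x)" for x
  proof (cases "x \<in> Q")
    case True
    then obtain R where R: "R \<in> S" "x \<in> core S R" "R \<subseteq> Q"
      using core_exists[OF assms(1,2,4) True] assms(4) by metis
    have "(\<Sum>T | T \<in> S \<and> T \<subseteq> Q. g x * indicator (core S T) x) =
        (\<Sum>T | T \<in> S \<and> T \<subseteq> Q. if T = R then g x else 0)"
      by (intro sum.cong) (simp_all add: indicator_core[OF assms(2) R(1) _ R(2)])
    also have "\<dots> = g x" using R assms(1) by simp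
    finally show ?thesis using True by simp
  next
    case False
    then show ?thesis using core_subset[of S] by (intro trans[OF _ sum.neutral[symmetric]]) (auto simp: indicator_def)
  qed
  then have "(\<integral>\<^sup>+x\<in>Q. g x \<partial>M) = (\<integral>\<^sup>+x. (\<Sum>R | R \<in> S \<and> R \<subseteq> Q. g x * indicator (core S R) x) \<partial>M)"
    by simp
  also have "\<dots> = (\<Sum>R | R \<in> S \<and> R \<subseteq> Q. \<integral>\<^sup>+x\<in>core S R. g x \<partial>M)"
    using core_sets[OF assms(1,3)] assms(5)
    by (intro nn_integral_sum borel_measurable_times_ennreal borel_measurable_indicator) auto
  finally show ?thesis .
qed

text \<open>Only the maximal members matter, and they are disjoint. The induction splits off a
  maximal member \<open>R\<close>: every other member lies inside \<open>R\<close> or is disjoint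
  from it.\<close>

lemma laminar_union_average:
  assumes "finite S" "laminar S" "S \<subseteq> sets M" "g \<in> borel_measurable M"
    and "\<And>Q. Q \<in> S \<Longrightarrow> t * emeasure M Q \<le> (\<integral>\<^sup>+x\<in>Q. g x \<partial>M)"
  shows "t * emeasure M (\<Union>S) \<le> (\<integral>\<^sup>+x\<in>\<Union>S. g x \<partial>M)"
  using assms
proof (induction "card S" arbitrary: S rule: less_induct)
  case less
  show ?case
  proof (cases "S = {}")
    case False
    obtain R where R: "R \<in> S" "\<forall>Q\<in>S. R \<subseteq> Q \<longrightarrow> R = Q"
      using finite_has_maximal[OF less.prems(1) False] by (rule bexE)
    define T where "T = {Q \<in> S. Q \<inter> R = {}}"
    have TS: "T \<subseteq> S" by (auto simp: T_def)
    have "\<Union>T \<in> sets M" using less.prems TS by (intro sets.finite_Union) (auto intro: finite_subset)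
    have un: "\<Union>S = R \<union> \<Union>T"
      using R less.prems(2) unfolding laminar_def T_def by blast
    have dj: "R \<inter> \<Union>T = {}" by (auto simp: T_def)
    show ?thesis
    proof (cases "R = {}")
      \<comment> \<open>The empty set is disjoint from itself, so \<open>T\<close> would not be
        smaller than \<open>S\<close>; but an empty maximal member is the only member.\<close>
      case True
      then have "S = {R}" using R by blast
      then show ?thesis using True by simp
    next
      case False
      then have "T \<subset> S" using R TS by (auto simp: T_def)
      then have "card T < card S" using less.prems(1) by (rule psubset_card_mono[rotated])
      then have IH: "t * emeasure M (\<Union>T) \<le> (\<integral>\<^sup>+x\<in>\<Union>T. g x \<partial>M)"
        using less.prems TS laminar_subset[OF less.prems(2) TS] finite_subset[OF TS less.prems(1)]
        by (intro less.hyps) auto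
      have "t * emeasure M (\<Union>S) = t * emeasure M R + t * emeasure M (\<Union>T)"
        unfolding un using R less.prems(3) \<open>\<Union>T \<in> sets M\<close> dj
        by (subst plus_emeasure[symmetric]) (auto simp: distrib_left)
      also have "\<dots> \<le> (\<integral>\<^sup>+x\<in>R. g x \<partial>M) + (\<integral>\<^sup>+x\<in>\<Union>T. g x \<partial>M)"
        using less.prems(5)[OF R(1)] IH by (rule add_mono)
      also have "\<dots> = (\<integral>\<^sup>+x\<in>\<Union>S. g x \<partial>M)"
        unfolding un using R less.prems(3,4) \<open>\<Union>T \<in> sets M\<close> dj
        by (intro nn_integral_disjoint_pair[symmetric]) auto
      finally show ?thesis .
    qed
  qed simp
qed

text \<open>The stopping family of Calderon and Zygmund, decided from large sets to small ones: the
  induction removes a minimal set \<open>R\<close> and adds it back only if no chosen set above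
  controls it up to a factor 2. By minimality nothing chosen earlier lies strictly inside
  \<open>R\<close>, so only pairs with \<open>R\<close> as the smaller set are new.\<close>

lemma principal_sets:
  fixes a :: "'a set \<Rightarrow> real"
  assumes "finite D" "\<And>Q. Q \<in> D \<Longrightarrow> 0 \<le> a Q"
  shows "\<exists>S\<subseteq>D. (\<forall>R\<in>D. \<exists>Q\<in>S. R \<subseteq> Q \<and> a R \<le> 2 * a Q) \<and> (\<forall>Q\<in>S. \<forall>R\<in>S. R \<subset> Q \<longrightarrow> 2 * a Q < a R)"
  using assms
proof (induction "card D" arbitrary: D rule: less_induct)
  case less
  show ?case
  proof (cases "D = {}")
    case False
    obtain R where R: "R \<in> D" "\<forall>Q\<in>D. Q \<subseteq> R \<longrightarrow> R = Q"
      using finite_has_minimal[OF less.prems(1) False] by (rule bexE)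
    have "card (D - {R}) < card D" using R less.prems(1) by (metis card_Diff1_less)
    then obtain S where S: "S \<subseteq> D - {R}" "\<forall>R\<in>D - {R}. \<exists>Q\<in>S. R \<subseteq> Q \<and> a R \<le> 2 * a Q"
        "\<forall>Q\<in>S. \<forall>R\<in>S. R \<subset> Q \<longrightarrow> 2 * a Q < a R"
      using less.hyps[of "D - {R}"] less.prems by auto
    show ?thesis
    proof (cases "\<exists>Q\<in>S. R \<subseteq> Q \<and> a R \<le> 2 * a Q")
      case True
      then show ?thesis using S by (intro exI[of _ S]) auto
    next
      case no: False
      have "a R \<le> 2 * a R" using less.prems(2)[OF R(1)] by simp
      show ?thesis
      proof (intro exI[of _ "insert R S"] conjI ballI impI)
        show "insert R S \<subseteq> D" using S R by auto
        show "\<exists>Q\<in>insert R S. T \<subseteq> Q \<and> a T \<le> 2 * a Q" if "T \<in> D" for T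
          using S(2) that \<open>a R \<le> 2 * a R\<close> by (cases "T = R") auto
        fix Q T assume "Q \<in> insert R S" "T \<in> insert R S" "T \<subset> Q"
        moreover have "Q \<noteq> R" using calculation R S(1) by auto
        ultimately show "2 * a Q < a T" using S(3) no by (cases "T = R") (auto simp: not_le)
      qed
    qed
  qed simp
qed

text \<open>The smaller members have averages above \<open>2 * a Q\<close>, and by
  \<open>laminar_union_average\<close> so has their union, up to equality. Its integral is at most
  \<open>a Q\<close> times the measure of \<open>Q\<close>, so it fills at most half of
  \<open>Q\<close>.\<close>

lemma core_large:
  assumes "finite S" "laminar S" "S \<subseteq> sets M" "Q \<in> S" "g \<in> borel_measurable M"
    and finQ: "emeasure M Q < \<infinity>"
    and avg: "\<And>R. R \<in> S \<Longrightarrow> ennreal (a R) * emeasure M R = (\<integral>\<^sup>+x\<in>R. g x \<partial>M)"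
    and a0: "\<And>R. R \<in> S \<Longrightarrow> 0 \<le> a R"
    and pos: "\<And>R. R \<in> S \<Longrightarrow> emeasure M R \<noteq> 0"
    and stop: "\<And>R. R \<in> S \<Longrightarrow> R \<subset> Q \<Longrightarrow> 2 * a Q < a R"
  shows "emeasure M Q \<le> 2 * emeasure M (core S Q)"
proof -
  define T where "T = {R \<in> S. R \<subset> Q}"
  have TS: "T \<subseteq> S" by (auto simp: T_def)
  have sU: "\<Union>T \<in> sets M" using assms TS by (intro sets.finite_Union) (auto intro: finite_subset)
  have UQ: "\<Union>T \<subseteq> Q" by (auto simp: T_def)
  have sQ: "Q \<in> sets M" using assms by auto
  have mono: "(\<integral>\<^sup>+x\<in>A. g x \<partial>M) \<le> (\<integral>\<^sup>+x\<in>B. g x \<partial>M)" if "A \<subseteq> B" for A B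
    using that by (intro nn_integral_mono) (auto simp: indicator_def)
  have half: "2 * emeasure M (\<Union>T) \<le> emeasure M Q"
  proof (cases "a Q = 0")
    \<comment> \<open>Here \<open>a Q\<close> cannot be cancelled. But \<open>g\<close> has integral
      0 over \<open>Q\<close>, while a smaller member would have a positive average, so there is
      none.\<close>
    case True
    have "T = {}"
    proof (rule ccontr)
      assume "T \<noteq> {}"
      then obtain R where R: "R \<in> S" "R \<subset> Q" by (auto simp: T_def)
      have "(\<integral>\<^sup>+x\<in>R. g x \<partial>M) \<le> 0" using mono[of R Q] avg[OF assms(4)] R True by auto
      then have "ennreal (a R) * emeasure M R = 0" using avg[OF R(1)] by simp
      then show False using stop[OF R] True pos[OF R(1)] by (simp add: ennreal_eq_0_iff)
    qed
    then show ?thesis by simp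
  next
    case False
    then have aQ: "0 < a Q" using a0[OF assms(4)] by simp
    have "ennreal (2 * a Q) * emeasure M (\<Union>T) \<le> (\<integral>\<^sup>+x\<in>\<Union>T. g x \<partial>M)"
    proof (rule laminar_union_average)
      show "ennreal (2 * a Q) * emeasure M R \<le> (\<integral>\<^sup>+x\<in>R. g x \<partial>M)" if "R \<in> T" for R
        using that stop[of R] TS
        by (subst avg[symmetric]) (auto simp: T_def intro!: mult_right_mono ennreal_leI)
    qed (use assms TS laminar_subset[OF assms(2) TS] in \<open>auto intro: finite_subset\<close>)
    also have "\<dots> \<le> (\<integral>\<^sup>+x\<in>Q. g x \<partial>M)" by (rule mono[OF UQ])
    also have "\<dots> = ennreal (a Q) * emeasure M Q" by (rule avg[OF assms(4), symmetric])
    finally have "ennreal (a Q) * (2 * emeasure M (\<Union>T)) \<le> ennreal (a Q) * emeasure M Q"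
      using aQ by (simp add: ennreal_mult' mult_ac)
    then show ?thesis using aQ by (simp add: ennreal_mult_le_mult_iff)
  qed
  have "emeasure M Q = emeasure M (\<Union>T) + emeasure M (core S Q)"
    using sU sQ UQ unfolding core_def T_def[symmetric]
    by (subst plus_emeasure) (auto simp: Un_absorb1)
  then have "emeasure M Q + emeasure M Q = 2 * emeasure M (\<Union>T) + 2 * emeasure M (core S Q)"
    by (metis distrib_left mult_2)
  also have "\<dots> \<le> emeasure M Q + 2 * emeasure M (core S Q)"
    using half by (rule add_right_mono)
  finally show ?thesis using finQ by (auto simp: ennreal_add_left_cancel_le)
qed

text \<open>Half-open, so that dyadic cubes of one generation are disjoint and grids are exactly
  laminar. Passing to the closed cubes of \<open>cubes\<close> changes only a null set.\<close>

definition hcube :: "real^'n \<Rightarrow> real \<Rightarrow> (real^'n) set" where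
  "hcube a l = {x. \<forall>i. a $ i \<le> x $ i \<and> x $ i < a $ i + l}"

lemma hcube_sets [measurable]: "hcube a l \<in> sets borel"
proof -
  have "hcube a l = (\<Inter>i. {x. a $ i \<le> x $ i} \<inter> {x. x $ i < a $ i + l})"
    by (auto simp: hcube_def)
  also have "\<dots> \<in> sets borel"
    by (intro sets.finite_INT sets.Int borel_closed borel_open closed_halfspace_component_ge_cart
        open_halfspace_component_lt_cart) auto
  finally show ?thesis .
qed

lemma hcube_subset_cbox: "hcube a l \<subseteq> cbox a (\<chi> i. a $ i + l)"
  by (auto simp: hcube_def mem_box_cart) (meson less_imp_le)

lemma nn_integral_hcube:
  "(\<integral>\<^sup>+x\<in>hcube a l. g x \<partial>lebesgue) = (\<integral>\<^sup>+x\<in>cbox a (\<chi> i. a $ i + l). g x \<partial>lebesgue)"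
proof (rule nn_integral_cong_AE)
  let ?b = "\<chi> i. a $ i + l"
  have "cbox a ?b - box a ?b \<in> null_sets lebesgue"
    using negligible_frontier_interval negligible_iff_null_sets by blast
  then have "AE x in lebesgue. x \<notin> cbox a ?b - box a ?b" by (rule AE_not_in)
  then show "AE x in lebesgue. g x * indicator (hcube a l) x = g x * indicator (cbox a ?b) x"
  proof eventually_elim
    case (elim x)
    then have "x \<in> hcube a l \<longleftrightarrow> x \<in> cbox a ?b"
      by (auto simp: hcube_def mem_box_cart intro: less_imp_le)
    then show ?case by (simp add: indicator_def)
  qed
qed

lemma emeasure_hcube:
  fixes a :: "real^'n"
  assumes "0 \<le> l"
  shows "emeasure lebesgue (hcube a l) = ennreal (l ^ CARD('n))"
    and "emeasure lebesgue (cbox a (\<chi> i. a $ i + l)) = ennreal (l ^ CARD('n))"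
proof -
  let ?b = "\<chi> i. a $ i + l"
  have ne: "cbox a ?b \<noteq> {}" using assms by (simp add: interval_ne_empty_cart)
  have "emeasure lebesgue (cbox a ?b) = ennreal (measure lebesgue (cbox a ?b))"
    by (intro emeasure_eq_ennreal_measure) (simp add: emeasure_lborel_cbox_eq)
  also have "measure lebesgue (cbox a ?b) = l ^ CARD('n)" using content_cbox_cart[OF ne] by simp
  finally show *: "emeasure lebesgue (cbox a ?b) = ennreal (l ^ CARD('n))" .
  show "emeasure lebesgue (hcube a l) = ennreal (l ^ CARD('n))"
    using nn_integral_hcube[of "\<lambda>_. 1" a l] * by simp
qed

lemma average_hcube:
  fixes a :: "real^'n"
  assumes "0 \<le> l"
  shows "average (hcube a l) g = average (cbox a (\<chi> i. a $ i + l)) g"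
  unfolding average_def nn_integral_hcube emeasure_hcube[OF assms] ..

lemma average_hcube_le_maximal_op:
  assumes "0 < l" "x \<in> hcube a l"
  shows "average (hcube a l) (\<lambda>y. ennreal \<bar>f y\<bar>) \<le> maximal_op f x"
  unfolding average_hcube[OF less_imp_le[OF assms(1)]] maximal_op_def
  using assms hcube_subset_cbox[of a l] by (intro SUP_upper) (auto simp: cubes_def)

section \<open>Sparse families in weighted variable Lebesgue spaces\<close>

lemma epowr_ennreal: "0 \<le> a \<Longrightarrow> 0 < s \<Longrightarrow> epowr (ennreal a) s = ennreal (a powr s)"
  by (auto simp: epowr_def ennreal_eq_0_iff)

lemma epowr_mono: "a \<le> b \<Longrightarrow> 0 < s \<Longrightarrow> epowr a s \<le> epowr b s"
  by (cases a; cases b) (auto simp: epowr_ennreal epowr_def[of \<infinity>] epowr_def[of top] intro!: ennreal_leI powr_mono2 dest: top.extremum_uniqueI)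

lemma hcube_lebesgue [measurable]: "hcube a l \<in> sets lebesgue"
  using hcube_sets[of a l] by (intro sets_completionI_sets) simp

text \<open>The hypotheses in working form: one bound \<open>P\<close> for both exponents, real
  powers of a weight that is positive almost everywhere, and boundedness of \<open>M\<close> on unit
  balls, where a norm bound becomes a modular bound.\<close>

locale weighted_exponent =
  fixes p w :: "real^'n \<Rightarrow> real" and P C :: real
  assumes p_meas [measurable]: "p \<in> borel_measurable lebesgue"
    and w_meas [measurable]: "w \<in> borel_measurable lebesgue"
    and w_nonneg: "\<And>x. 0 \<le> w x"
    and p_ge_1: "\<And>x. 1 \<le> p x"
    and P_ge_1: "1 \<le> P" and C_ge_1: "1 \<le> C"
    and regular: "AE x in lebesgue. 0 < w x \<and> 1 < p x \<and> p x \<le> P \<and> conj_exponent p x \<le> P"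
    and weight_integrable:
      "\<And>a l. (\<integral>\<^sup>+x\<in>hcube a l. ennreal (w x powr p x) \<partial>lebesgue) < \<infinity>"
      "\<And>a l. (\<integral>\<^sup>+x\<in>hcube a l. ennreal ((1 / w x) powr conj_exponent p x) \<partial>lebesgue) < \<infinity>"
    and maximal_bound: "\<And>f. f \<in> borel_measurable lebesgue \<Longrightarrow> (\<And>x. 0 \<le> f x) \<Longrightarrow>
      (\<integral>\<^sup>+x. ennreal ((f x * w x) powr p x) \<partial>lebesgue) \<le> 1 \<Longrightarrow>
      modular p (\<lambda>x. maximal_op f x * ennreal (w x) / ennreal C) \<le> 1"
begin

abbreviation q where "q \<equiv> conj_exponent p"

lemma q_meas [measurable]: "q \<in> borel_measurable lebesgue"
  unfolding conj_exponent_def[abs_def] by measurable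

lemma conj_identities:
  assumes "1 < p x"
  shows "1 < q x" "(q x - 1) * p x = q x"
  using assms by (auto simp: conj_exponent_def field_simps)

lemma young: "1 < p x \<Longrightarrow> 0 \<le> a \<Longrightarrow> 0 \<le> b \<Longrightarrow> a * b \<le> a powr p x + b powr q x"
  unfolding conj_exponent_def by (rule powr_young)

text \<open>\<open>M f\<close> may be infinite and its modular uses \<open>epowr\<close>; a
  real-valued minorant brings the bound back to real powers.\<close>

lemma maximal_bound_minorant:
  assumes "f \<in> borel_measurable lebesgue" "\<And>x. 0 \<le> f x"
    "(\<integral>\<^sup>+x. ennreal ((f x * w x) powr p x) \<partial>lebesgue) \<le> 1"
    and h: "\<And>x. 0 \<le> h x" "\<And>x. ennreal (h x) \<le> maximal_op f x"
  shows "(\<integral>\<^sup>+x. ennreal ((h x / C * w x) powr p x) \<partial>lebesgue) \<le> 1"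
proof -
  have "ennreal ((h x / C * w x) powr p x) \<le> epowr (maximal_op f x * ennreal (w x) / ennreal C) (p x)" for x
  proof -
    have "ennreal ((h x / C * w x) powr p x) = epowr (ennreal (h x / C * w x)) (p x)"
      using h(1)[of x] w_nonneg[of x] C_ge_1 p_ge_1[of x] by (intro epowr_ennreal[symmetric]) auto
    also have "\<dots> \<le> epowr (maximal_op f x * ennreal (w x) / ennreal C) (p x)"
    proof (rule epowr_mono)
      have "ennreal (h x / C * w x) = ennreal (h x) * ennreal (w x) / ennreal C"
        using h(1)[of x] w_nonneg[of x] C_ge_1
        by (simp add: ennreal_mult[symmetric] divide_ennreal)
      also have "\<dots> \<le> maximal_op f x * ennreal (w x) / ennreal C"
        by (intro divide_right_mono_ennreal mult_right_mono h) auto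
      finally show "ennreal (h x / C * w x) \<le> maximal_op f x * ennreal (w x) / ennreal C" .
    qed (use p_ge_1[of x] in simp)
    finally show ?thesis .
  qed
  then have "(\<integral>\<^sup>+x. ennreal ((h x / C * w x) powr p x) \<partial>lebesgue) \<le>
      modular p (\<lambda>x. maximal_op f x * ennreal (w x) / ennreal C)"
    unfolding modular_def by (rule nn_integral_mono)
  also have "\<dots> \<le> 1" using assms by (intro maximal_bound)
  finally show ?thesis .
qed

text \<open>Young's inequality applied to g = w * (g / w), with w^p integrable on the cube.\<close>

lemma integrable_on_hcube:
  assumes "g \<in> borel_measurable lebesgue" "\<And>x. 0 \<le> g x"
    and "(\<integral>\<^sup>+x. ennreal ((g x / w x) powr q x) \<partial>lebesgue) < \<infinity>"
  shows "(\<integral>\<^sup>+x\<in>hcube a l. ennreal (g x) \<partial>lebesgue) < \<infinity>"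
proof -
  note [measurable] = assms(1)
  have "(\<integral>\<^sup>+x\<in>hcube a l. ennreal (g x) \<partial>lebesgue) \<le>
      (\<integral>\<^sup>+x. ennreal (w x powr p x) * indicator (hcube a l) x + ennreal ((g x / w x) powr q x) \<partial>lebesgue)"
  proof (rule nn_integral_mono_AE)
    show "AE x in lebesgue. ennreal (g x) * indicator (hcube a l) x \<le>
        ennreal (w x powr p x) * indicator (hcube a l) x + ennreal ((g x / w x) powr q x)"
      using regular
    proof eventually_elim
      case (elim x)
      then have "g x \<le> w x powr p x + (g x / w x) powr q x"
        using young[of x "w x" "g x / w x"] assms(2)[of x] by simp
      then have "ennreal (g x) \<le> ennreal (w x powr p x) + ennreal ((g x / w x) powr q x)"
        by (simp add: ennreal_plus[symmetric] ennreal_leI del: ennreal_plus)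
      then show ?case by (simp add: indicator_def)
    qed
  qed
  also have "\<dots> < \<infinity>"
    using weight_integrable(1)[of a l] assms(3) by (subst nn_integral_add) (auto simp: ennreal_add_less_top)
  finally show ?thesis .
qed

end

locale sparse_family = weighted_exponent p w P C for p w :: "real^'n \<Rightarrow> real" and P C +
  fixes S :: "(real^'n) set set"
  assumes fin: "finite S" and lam: "laminar S"
    and cubes: "\<And>Q. Q \<in> S \<Longrightarrow> \<exists>a l. 0 < l \<and> Q = hcube a l"
    and sparse: "\<And>Q. Q \<in> S \<Longrightarrow> emeasure lebesgue Q \<le> 2 * emeasure lebesgue (core S Q)"
begin

lemma S_sets: "S \<subseteq> sets lebesgue"
proof
  fix Q assume "Q \<in> S"
  then obtain a l where "Q = hcube a l" using cubes by blast
  then show "Q \<in> sets lebesgue" by simp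
qed

lemma core_S [measurable]: "Q \<in> S \<Longrightarrow> core S Q \<in> sets lebesgue"
  by (rule core_sets[OF fin S_sets])

lemma step_meas [measurable]: "step S \<alpha> \<in> borel_measurable lebesgue"
  by (rule step_measurable[OF fin S_sets])

lemma volume:
  assumes "Q \<in> S"
  shows "emeasure lebesgue Q = ennreal (measure lebesgue Q)" "0 < measure lebesgue Q"
    "average Q g = (\<integral>\<^sup>+x\<in>Q. g x \<partial>lebesgue) / ennreal (measure lebesgue Q)"
proof -
  obtain a l where l: "0 < l" "Q = hcube a l" using cubes[OF assms] by blast
  have e: "emeasure lebesgue Q = ennreal (l ^ CARD('n))"
    unfolding l(2) using l(1) by (intro emeasure_hcube) simp
  then have m: "measure lebesgue Q = l ^ CARD('n)" using l(1) by (simp add: measure_def)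
  show "emeasure lebesgue Q = ennreal (measure lebesgue Q)" unfolding e m ..
  then show "average Q g = (\<integral>\<^sup>+x\<in>Q. g x \<partial>lebesgue) / ennreal (measure lebesgue Q)"
    by (simp add: average_def)
  show "0 < measure lebesgue Q" unfolding m using l(1) by simp
qed

lemma average_le_maximal_op:
  assumes "Q \<in> S" "x \<in> Q"
  shows "average Q (\<lambda>y. ennreal \<bar>f y\<bar>) \<le> maximal_op f x"
  using cubes[OF assms(1)] assms(2) average_hcube_le_maximal_op by blast

definition \<phi> :: "(real^'n) set \<Rightarrow> real \<Rightarrow> real" where
  "\<phi> Q t = enn2real (\<integral>\<^sup>+x\<in>core S Q. ennreal ((t * w x) powr p x) \<partial>lebesgue)"

lemma AE_core_mono:
  assumes "AE x in lebesgue. 0 < w x \<and> 1 < p x \<and> p x \<le> P \<and> q x \<le> P \<longrightarrow> F x \<le> G x"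
  shows "(\<integral>\<^sup>+x\<in>A. F x \<partial>lebesgue) \<le> (\<integral>\<^sup>+x\<in>A. G x \<partial>lebesgue)"
  using assms regular by (intro nn_integral_mono_AE) (auto simp: indicator_def)

lemma powr_scale_bound:
  assumes "0 \<le> t" "0 \<le> u" "1 \<le> e" "e \<le> P"
  shows "(t * u) powr e \<le> max 1 t powr P * u powr e"
proof -
  have "(t * u) powr e \<le> (max 1 t * u) powr e" using assms by (intro powr_mono2 mult_right_mono) auto
  also have "\<dots> = max 1 t powr e * u powr e" using assms by (intro powr_mult) 
  also have "\<dots> \<le> max 1 t powr P * u powr e" using assms by (intro mult_right_mono powr_mono) auto
  finally show ?thesis .
qed

lemma core_integral_finite:
  assumes "Q \<in> S" "0 \<le> t"
  shows "(\<integral>\<^sup>+x\<in>core S Q. ennreal ((t * w x) powr p x) \<partial>lebesgue) < \<infinity>"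
    and "(\<integral>\<^sup>+x\<in>core S Q. ennreal ((t / w x) powr q x) \<partial>lebesgue) < \<infinity>"
proof -
  obtain a l where l: "Q = hcube a l" using cubes[OF assms(1)] by blast
  have bound: "(\<integral>\<^sup>+x\<in>core S Q. F x \<partial>lebesgue) < \<infinity>"
    if G: "(\<integral>\<^sup>+x\<in>hcube a l. ennreal (G x) \<partial>lebesgue) < \<infinity>" "G \<in> borel_measurable lebesgue"
      and le: "AE x in lebesgue. 0 < w x \<and> 1 < p x \<and> p x \<le> P \<and> q x \<le> P \<longrightarrow>
        F x \<le> ennreal (max 1 t powr P * G x)" for F G
  proof -
    have "(\<integral>\<^sup>+x\<in>core S Q. F x \<partial>lebesgue) \<le> (\<integral>\<^sup>+x\<in>core S Q. ennreal (max 1 t powr P * G x) \<partial>lebesgue)"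
      by (rule AE_core_mono[OF le])
    also have "\<dots> \<le> (\<integral>\<^sup>+x. ennreal (max 1 t powr P) * (ennreal (G x) * indicator (hcube a l) x) \<partial>lebesgue)"
      using core_subset[of S Q] unfolding l
      by (intro nn_integral_mono) (auto simp: indicator_def ennreal_mult')
    also have "\<dots> = ennreal (max 1 t powr P) * (\<integral>\<^sup>+x\<in>hcube a l. ennreal (G x) \<partial>lebesgue)"
      using G(2) by (intro nn_integral_cmult) simp
    also have "\<dots> < \<infinity>" using G(1) by (simp add: ennreal_mult_less_top)
    finally show ?thesis .
  qed
  show "(\<integral>\<^sup>+x\<in>core S Q. ennreal ((t * w x) powr p x) \<partial>lebesgue) < \<infinity>"
    using assms(2) by (intro bound[OF weight_integrable(1)]) (auto intro!: ennreal_leI powr_scale_bound)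
  have "(t / w x) powr q x \<le> max 1 t powr P * (1 / w x) powr q x" if "0 < w x" "1 < p x" "q x \<le> P" for x
    using powr_scale_bound[of t "1 / w x" "q x"] conj_identities(1)[of x] assms(2) that by simp
  then show "(\<integral>\<^sup>+x\<in>core S Q. ennreal ((t / w x) powr q x) \<partial>lebesgue) < \<infinity>"
    by (intro bound[OF weight_integrable(2)]) (auto intro!: ennreal_leI)
qed

lemma \<phi>_eq: "Q \<in> S \<Longrightarrow> 0 \<le> t \<Longrightarrow>
    ennreal (\<phi> Q t) = (\<integral>\<^sup>+x\<in>core S Q. ennreal ((t * w x) powr p x) \<partial>lebesgue)"
  using core_integral_finite(1)[of Q t] by (simp add: \<phi>_def)

lemma \<phi>_nonneg: "0 \<le> \<phi> Q t"
  by (simp add: \<phi>_def)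

lemma \<phi>_scale:
  assumes Q: "Q \<in> S" "0 \<le> s" "0 \<le> t" "0 \<le> c"
    and le: "\<And>x. 0 < w x \<Longrightarrow> 1 < p x \<Longrightarrow> p x \<le> P \<Longrightarrow> (s * w x) powr p x \<le> c * (t * w x) powr p x"
  shows "\<phi> Q s \<le> c * \<phi> Q t"
proof -
  have "ennreal (\<phi> Q s) \<le> (\<integral>\<^sup>+x\<in>core S Q. ennreal (c * (t * w x) powr p x) \<partial>lebesgue)"
    unfolding \<phi>_eq[OF Q(1,2)] using le by (intro AE_core_mono AE_I2 impI ennreal_leI) auto
  also have "\<dots> = (\<integral>\<^sup>+x. ennreal c * (ennreal ((t * w x) powr p x) * indicator (core S Q) x) \<partial>lebesgue)"
    using Q(4) by (simp add: ennreal_mult' mult.assoc)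
  also have "\<dots> = ennreal c * ennreal (\<phi> Q t)"
    unfolding \<phi>_eq[OF Q(1,3)] using Q(1) by (intro nn_integral_cmult) simp
  also have "\<dots> = ennreal (c * \<phi> Q t)" using Q(4) by (simp add: ennreal_mult')
  finally show ?thesis using Q(4) \<phi>_nonneg by (subst (asm) ennreal_le_iff) auto
qed

lemma modular_step:
  assumes "\<And>Q. Q \<in> S \<Longrightarrow> 0 \<le> \<alpha> Q"
  shows "(\<integral>\<^sup>+x. ennreal ((step S \<alpha> x * w x) powr p x) \<partial>lebesgue) = ennreal (\<Sum>Q\<in>S. \<phi> Q (\<alpha> Q))"
proof -
  have "(\<integral>\<^sup>+x. ennreal ((step S \<alpha> x * w x) powr p x) \<partial>lebesgue) =
      (\<Sum>Q\<in>S. \<integral>\<^sup>+x\<in>core S Q. ennreal ((\<alpha> Q * w x) powr p x) \<partial>lebesgue)"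
    by (rule nn_integral_step[OF fin lam S_sets, of "\<lambda>t x. ennreal ((t * w x) powr p x)"]) auto
  also have "\<dots> = (\<Sum>Q\<in>S. ennreal (\<phi> Q (\<alpha> Q)))" using assms by (simp add: \<phi>_eq)
  finally show ?thesis using \<phi>_nonneg by simp
qed

text \<open>To verify \<open>maximal\<close>, take the step function \<open>f\<close> of \<alpha>.
  On E(R) with R inside Q, \<open>M f\<close> is at least the mean of \<open>f\<close> over Q, hence
  at least \<alpha>_Q |E(Q)| / |Q|, which sparsity bounds below by \<alpha>_Q / 2. This is the 2 in
  the constant \<open>2 * C\<close>.\<close>

sublocale forest_modular S \<phi> "2 * C" P
proof
  show "finite S" by (rule fin)
  show "Q \<noteq> {}" if "Q \<in> S" for Q
    using volume(1,2)[OF that] by auto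
  show "Q \<inter> R = {} \<or> Q \<subseteq> R \<or> R \<subseteq> Q" if "Q \<in> S" "R \<in> S" for Q R
    using lam that by (simp add: laminar_def)
  show "1 \<le> 2 * C" "1 \<le> P" using C_ge_1 P_ge_1 by auto
  show "0 \<le> \<phi> Q t" for Q t by (rule \<phi>_nonneg)
  show "\<phi> Q s \<le> \<phi> Q t" if "Q \<in> S" "0 \<le> s" "s \<le> t" for Q s t
  proof -
    have "(s * w x) powr p x \<le> 1 * (t * w x) powr p x" if "0 < w x" "1 < p x" for x
      using that \<open>0 \<le> s\<close> \<open>s \<le> t\<close> by (auto intro!: powr_mono2 mult_right_mono)
    then show ?thesis using \<phi>_scale[of Q s t 1] that by simp
  qed
  show "\<phi> Q (c * t) \<le> c * \<phi> Q t" if "Q \<in> S" "0 \<le> t" "0 \<le> c" "c \<le> 1" for Q t c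
  proof (rule \<phi>_scale)
    fix x assume x: "0 < w x" "1 < p x"
    have "c powr p x \<le> c powr 1" using that x by (intro powr_mono') auto
    then have "c powr p x * (t * w x) powr p x \<le> c * (t * w x) powr p x"
      using that by (intro mult_right_mono) auto
    then show "(c * t * w x) powr p x \<le> c * (t * w x) powr p x"
      using that x by (simp add: powr_mult mult.assoc)
  qed (use that in auto)
  show "\<phi> Q (c * t) \<le> c powr P * \<phi> Q t" if "Q \<in> S" "0 \<le> t" "1 \<le> c" for Q t c
  proof (rule \<phi>_scale)
    fix x assume x: "0 < w x" "1 < p x" "p x \<le> P"
    then show "(c * t * w x) powr p x \<le> c powr P * (t * w x) powr p x"
      using powr_scale_bound[of c "t * w x" "p x"] that by (simp add: mult.assoc)
  qed (use that in auto)
  fix \<alpha> \<gamma> :: "(real^'n) set \<Rightarrow> real"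
  assume \<alpha>: "\<And>Q. Q \<in> S \<Longrightarrow> 0 \<le> \<alpha> Q" and \<gamma>: "\<And>Q. Q \<in> S \<Longrightarrow> 0 \<le> \<gamma> Q"
    and gen: "\<And>R. R \<in> S \<Longrightarrow> \<exists>Q\<in>S. R \<subseteq> Q \<and> \<gamma> R \<le> \<alpha> Q"
    and le1: "(\<Sum>Q\<in>S. \<phi> Q (\<alpha> Q)) \<le> 1"
  define f where "f = step S \<alpha>"
  have f0: "0 \<le> f x" for x unfolding f_def using \<alpha> by (rule step_nonneg)
  have below: "ennreal (step S (\<lambda>Q. \<gamma> Q / 2) x) \<le> maximal_op f x" for x
  proof (cases "\<exists>R\<in>S. x \<in> core S R")
    case True
    then obtain R where R: "R \<in> S" "x \<in> core S R" by blast
    obtain Q where Q: "Q \<in> S" "R \<subseteq> Q" "\<gamma> R \<le> \<alpha> Q" using gen[OF R(1)] by blast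
    have "ennreal (\<alpha> Q) * emeasure lebesgue (core S Q) = (\<integral>\<^sup>+y\<in>core S Q. ennreal (\<alpha> Q) \<partial>lebesgue)"
      using Q(1) by (intro nn_integral_cmult_indicator[symmetric]) simp
    also have "\<dots> \<le> (\<integral>\<^sup>+y\<in>Q. ennreal \<bar>f y\<bar> \<partial>lebesgue)"
      using step_core[OF fin lam Q(1)] core_subset[of S Q] \<alpha>[OF Q(1)]
      by (intro nn_integral_mono) (auto simp: indicator_def f_def)
    finally have "2 * (ennreal (\<alpha> Q) * emeasure lebesgue (core S Q)) \<le> 2 * (\<integral>\<^sup>+y\<in>Q. ennreal \<bar>f y\<bar> \<partial>lebesgue)"
      by (rule mult_left_mono) simp
    moreover have "ennreal (\<alpha> Q) * emeasure lebesgue Q \<le> 2 * (ennreal (\<alpha> Q) * emeasure lebesgue (core S Q))"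
      using mult_left_mono[OF sparse[OF Q(1)], of "ennreal (\<alpha> Q)"] by (simp add: mult_ac)
    ultimately have "ennreal (\<alpha> Q) * ennreal (measure lebesgue Q) \<le> 2 * (\<integral>\<^sup>+y\<in>Q. ennreal \<bar>f y\<bar> \<partial>lebesgue)"
      unfolding volume(1)[OF Q(1), symmetric] by (rule order.trans[rotated])
    then have "ennreal (\<alpha> Q) * ennreal (measure lebesgue Q) / ennreal (measure lebesgue Q) \<le> 2 * average Q (\<lambda>y. ennreal \<bar>f y\<bar>)"
      unfolding volume(3)[OF Q(1)] by (simp add: ennreal_times_divide divide_right_mono_ennreal)
    then have "ennreal (\<alpha> Q) \<le> 2 * average Q (\<lambda>y. ennreal \<bar>f y\<bar>)"
      using volume(2)[OF Q(1)] \<alpha>[OF Q(1)] by (simp add: ennreal_mult[symmetric] divide_ennreal)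
    also have "\<dots> \<le> 2 * maximal_op f x"
      using Q R core_subset[of S R] by (intro mult_left_mono average_le_maximal_op) auto
    finally have "ennreal (\<alpha> Q) / 2 \<le> 2 * maximal_op f x / 2" by (rule divide_right_mono_ennreal)
    also have "\<dots> = maximal_op f x" by (simp add: mult.commute mult_divide_eq_ennreal)
    finally have "ennreal (\<alpha> Q / 2) \<le> maximal_op f x"
      using \<alpha>[OF Q(1)] by (simp add: divide_ennreal[symmetric])
    moreover have "ennreal (\<gamma> R / 2) \<le> ennreal (\<alpha> Q / 2)" using Q(3) by (intro ennreal_leI) auto
    ultimately show ?thesis using step_core[OF fin lam R] by simp
  qed (simp add: step_outside)
  have "(\<integral>\<^sup>+x. ennreal ((step S (\<lambda>Q. \<gamma> Q / 2) x / C * w x) powr p x) \<partial>lebesgue) \<le> 1"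
  proof (rule maximal_bound_minorant[OF _ f0 _ _ below])
    show "(\<integral>\<^sup>+x. ennreal ((f x * w x) powr p x) \<partial>lebesgue) \<le> 1"
      unfolding f_def using le1 modular_step[of \<alpha>] \<alpha> by simp
    show "0 \<le> step S (\<lambda>Q. \<gamma> Q / 2) x" for x using \<gamma> by (intro step_nonneg) auto
  qed (simp add: f_def)
  moreover have "step S (\<lambda>Q. \<gamma> Q / 2) x / C = step S (\<lambda>Q. \<gamma> Q / (2 * C)) x" for x
    by (simp add: step_def sum_divide_distrib)
  ultimately show "(\<Sum>Q\<in>S. \<phi> Q (\<gamma> Q / (2 * C))) \<le> 1"
    using modular_step[of "\<lambda>Q. \<gamma> Q / (2 * C)"] \<gamma> C_ge_1 by simp
qed

end

section \<open>Duality for the averages over a sparse family\<close>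

context sparse_family
begin

definition carleson_const :: real where "carleson_const = 8 * (2 * C) * real decay_steps"

lemma carleson_const_pos: "0 < carleson_const"
  using C_ge_1 by (simp add: carleson_const_def decay_steps_def)

text \<open>\<open>carleson_bound\<close> with \<psi>_Q the integral of \<open>g\<close> over E(Q).
  The cores below Q partition Q, and Young's inequality gives \<open>pairing\<close> its 2 as a sum
  of two modulars, each at most 1.\<close>

lemma carleson_pairing:
  assumes g [measurable]: "g \<in> borel_measurable lebesgue" and g0: "\<And>x. 0 \<le> g x"
    and g1: "(\<integral>\<^sup>+x. ennreal ((g x / w x) powr q x) \<partial>lebesgue) \<le> 1"
    and \<alpha>0: "\<And>Q. Q \<in> S \<Longrightarrow> 0 \<le> \<alpha> Q" and \<alpha>1: "(\<Sum>Q\<in>S. \<phi> Q (\<alpha> Q)) \<le> 1"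
  shows "(\<Sum>Q\<in>S. \<alpha> Q * enn2real (\<integral>\<^sup>+x\<in>Q. ennreal (g x) \<partial>lebesgue)) \<le> carleson_const"
proof -
  define \<psi> where "\<psi> Q = enn2real (\<integral>\<^sup>+x\<in>core S Q. ennreal (g x) \<partial>lebesgue)" for Q
  have finQ: "(\<integral>\<^sup>+x\<in>Q. ennreal (g x) \<partial>lebesgue) < \<infinity>" if Q: "Q \<in> S" for Q
  proof -
    have "(\<integral>\<^sup>+x. ennreal ((g x / w x) powr q x) \<partial>lebesgue) < \<infinity>"
      using order.strict_trans1[OF g1 ennreal_one_less_top] by simp
    moreover obtain a l where "Q = hcube a l" using cubes[OF Q] by blast
    ultimately show ?thesis using integrable_on_hcube[OF g g0] by simp
  qed
  have \<psi>_eq: "ennreal (\<psi> Q) = (\<integral>\<^sup>+x\<in>core S Q. ennreal (g x) \<partial>lebesgue)" if Q: "Q \<in> S" for Q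
  proof -
    have "(\<integral>\<^sup>+x\<in>core S Q. ennreal (g x) \<partial>lebesgue) \<le> (\<integral>\<^sup>+x\<in>Q. ennreal (g x) \<partial>lebesgue)"
      using core_subset[of S Q] by (intro nn_integral_mono) (auto simp: indicator_def)
    then show ?thesis using finQ[OF Q] by (simp add: \<psi>_def)
  qed
  have \<psi>0: "0 \<le> \<psi> Q" for Q by (simp add: \<psi>_def)
  have below: "enn2real (\<integral>\<^sup>+x\<in>Q. ennreal (g x) \<partial>lebesgue) = (\<Sum>R | R \<in> S \<and> R \<subseteq> Q. \<psi> R)" if Q: "Q \<in> S" for Q
  proof -
    have "(\<integral>\<^sup>+x\<in>Q. ennreal (g x) \<partial>lebesgue) = (\<Sum>R | R \<in> S \<and> R \<subseteq> Q. ennreal (\<psi> R))"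
      using \<psi>_eq by (subst nn_integral_cores_below[OF fin lam S_sets Q]) auto
    also have "\<dots> = ennreal (\<Sum>R | R \<in> S \<and> R \<subseteq> Q. \<psi> R)" using \<psi>0 by (intro sum_ennreal) auto
    finally show ?thesis using \<psi>0 by (simp add: sum_nonneg)
  qed
  have "(\<Sum>Q\<in>S. \<alpha> Q * (\<Sum>R | R \<in> S \<and> R \<subseteq> Q. \<psi> R)) \<le> 8 * (2 * C) * real decay_steps"
  proof (rule carleson_bound)
    fix \<beta> :: "(real^'n) set \<Rightarrow> real"
    assume \<beta>: "\<And>Q. Q \<in> S \<Longrightarrow> 0 \<le> \<beta> Q" "\<Phi> \<beta> \<le> 1"
    have "ennreal (\<Sum>Q\<in>S. \<psi> Q * \<beta> Q) = (\<Sum>Q\<in>S. ennreal (\<psi> Q * \<beta> Q))"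
      using \<psi>0 \<beta> by (intro sum_ennreal[symmetric]) auto
    also have "\<dots> = (\<Sum>Q\<in>S. \<integral>\<^sup>+x\<in>core S Q. (ennreal (\<beta> Q) * ennreal (g x)) \<partial>lebesgue)"
    proof (intro sum.cong refl)
      fix Q assume Q: "Q \<in> S"
      have "ennreal (\<psi> Q * \<beta> Q) = ennreal (\<beta> Q) * ennreal (\<psi> Q)"
        using \<psi>0 \<beta>(1)[OF Q] by (simp add: ennreal_mult mult.commute)
      also have "\<dots> = (\<integral>\<^sup>+x. ennreal (\<beta> Q) * (ennreal (g x) * indicator (core S Q) x) \<partial>lebesgue)"
        unfolding \<psi>_eq[OF Q] using Q by (intro nn_integral_cmult[symmetric]) simp
      finally show "ennreal (\<psi> Q * \<beta> Q) = (\<integral>\<^sup>+x\<in>core S Q. (ennreal (\<beta> Q) * ennreal (g x)) \<partial>lebesgue)"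
        by (simp add: mult.assoc)
    qed
    also have "\<dots> = (\<integral>\<^sup>+x. ennreal (step S \<beta> x) * ennreal (g x) \<partial>lebesgue)"
      by (rule nn_integral_step[OF fin lam S_sets, of "\<lambda>t x. ennreal t * ennreal (g x)", symmetric]) auto
    also have "\<dots> \<le> (\<integral>\<^sup>+x. ennreal ((step S \<beta> x * w x) powr p x) + ennreal ((g x / w x) powr q x) \<partial>lebesgue)"
    proof (rule nn_integral_mono_AE)
      show "AE x in lebesgue. ennreal (step S \<beta> x) * ennreal (g x) \<le>
          ennreal ((step S \<beta> x * w x) powr p x) + ennreal ((g x / w x) powr q x)"
        using regular
      proof eventually_elim
        case (elim x)
        have s0: "0 \<le> step S \<beta> x" using \<beta>(1) by (rule step_nonneg)
        have "step S \<beta> x * g x = (step S \<beta> x * w x) * (g x / w x)" using elim by simp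
        also have "\<dots> \<le> (step S \<beta> x * w x) powr p x + (g x / w x) powr q x"
          using elim s0 g0[of x] by (intro young) auto
        finally have "ennreal (step S \<beta> x * g x) \<le> ennreal ((step S \<beta> x * w x) powr p x + (g x / w x) powr q x)"
          by (rule ennreal_leI)
        then show ?case using s0 g0[of x] by (simp add: ennreal_mult)
      qed
    qed
    also have "\<dots> = ennreal (\<Phi> \<beta>) + (\<integral>\<^sup>+x. ennreal ((g x / w x) powr q x) \<partial>lebesgue)"
      by (subst nn_integral_add) (use modular_step[of \<beta>] \<beta> in \<open>auto simp: \<Phi>_def\<close>)
    also have "\<dots> \<le> ennreal 1 + ennreal 1" using \<beta>(2) g1 by (intro add_mono ennreal_leI) auto
    also have "\<dots> = ennreal 2" by (subst ennreal_plus[symmetric]) auto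
    finally show "(\<Sum>Q\<in>S. \<psi> Q * \<beta> Q) \<le> 2" by (subst (asm) ennreal_le_iff) auto
  qed (use \<psi>0 \<alpha>0 \<alpha>1 in \<open>auto simp: \<Phi>_def\<close>)
  then show ?thesis by (simp add: below carleson_const_def)
qed

text \<open>If the modular \<open>r\<close> exceeded 1, an explicit extremal \<open>f\<close> in the
  unit ball for \<open>p\<close> would pair with the step function of \<open>a\<close> to exactly
  \<open>2 * carleson_const * C\<close>. Moving the means from \<open>g\<close> to \<open>f\<close>
  rewrites this pairing in a form that \<open>carleson_pairing\<close> bounds by half of that
  number.\<close>

lemma dual_bound:
  assumes g [measurable]: "g \<in> borel_measurable lebesgue" and g0: "\<And>x. 0 \<le> g x"
    and g1: "(\<integral>\<^sup>+x. ennreal ((g x / w x) powr q x) \<partial>lebesgue) \<le> 1"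
    and a0: "\<And>Q. Q \<in> S \<Longrightarrow> 0 \<le> a Q"
    and avg: "\<And>Q. Q \<in> S \<Longrightarrow> a Q * measure lebesgue Q = enn2real (\<integral>\<^sup>+x\<in>Q. ennreal (g x) \<partial>lebesgue)"
  shows "(\<integral>\<^sup>+x. ennreal ((step S a x / (2 * carleson_const * C) / w x) powr q x) \<partial>lebesgue) \<le> 1"
proof (rule ccontr)
  assume neg: "\<not> ?thesis"
  define L where "L = 2 * carleson_const * C"
  have L: "0 < L" using carleson_const_pos C_ge_1 by (simp add: L_def)
  define u where "u x = step S a x / L / w x" for x
  have u_meas [measurable]: "u \<in> borel_measurable lebesgue" unfolding u_def[abs_def] by measurable
  have u0: "0 \<le> u x" for x
    unfolding u_def using L w_nonneg[of x] step_nonneg[of S a x] a0 by auto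
  define r where "r = enn2real (\<integral>\<^sup>+x. ennreal (u x powr q x) \<partial>lebesgue)"
  have "(\<integral>\<^sup>+x. ennreal (u x powr q x) \<partial>lebesgue) =
      (\<Sum>Q\<in>S. \<integral>\<^sup>+x\<in>core S Q. ennreal ((a Q / L / w x) powr q x) \<partial>lebesgue)"
    unfolding u_def by (rule nn_integral_step[OF fin lam S_sets, of "\<lambda>t x. ennreal ((t / L / w x) powr q x)"]) auto
  also have "\<dots> < \<infinity>"
  proof -
    have "(\<integral>\<^sup>+x\<in>core S Q. ennreal ((a Q / L / w x) powr q x) \<partial>lebesgue) < \<infinity>" if "Q \<in> S" for Q
      using that a0 L by (intro core_integral_finite(2)) auto
    then show ?thesis using fin unfolding infinity_ennreal_def ennreal_sum_less_top[OF fin] by blast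
  qed
  finally have r_eq: "ennreal r = (\<integral>\<^sup>+x. ennreal (u x powr q x) \<partial>lebesgue)"
    by (simp add: r_def)
  have r1: "1 < r" using neg unfolding u_def[symmetric] L_def[symmetric] r_eq[symmetric]
    by (simp add: not_le)
  \<comment> \<open>The extremal function of Hoelder's inequality, normalised by \<open>r\<close>,
    which is finite by the integrability on cores. Since (q - 1) p = q, the modular density of
    \<open>f\<close> is u^q / r^p, and r > 1 gives r^p \<ge> r.\<close>
  define f where "f x = u x powr (q x - 1) / (w x * r)" for x
  have f_meas [measurable]: "f \<in> borel_measurable lebesgue" unfolding f_def[abs_def] by measurable
  have f0: "0 \<le> f x" for x unfolding f_def using w_nonneg[of x] r1 by simp
  have scaled: "(\<integral>\<^sup>+x. ennreal (c * u x powr q x / r) \<partial>lebesgue) = ennreal c" if "0 \<le> c" for c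
  proof -
    have "(\<integral>\<^sup>+x. ennreal (c * u x powr q x / r) \<partial>lebesgue) =
        (\<integral>\<^sup>+x. ennreal (c / r) * ennreal (u x powr q x) \<partial>lebesgue)"
      using that r1 by (intro nn_integral_cong) (simp add: ennreal_mult[symmetric])
    also have "\<dots> = ennreal (c / r) * ennreal r" unfolding r_eq by (intro nn_integral_cmult) simp
    also have "\<dots> = ennreal c" using that r1 by (simp add: ennreal_mult[symmetric])
    finally show ?thesis .
  qed
  have f1: "(\<integral>\<^sup>+x. ennreal ((f x * w x) powr p x) \<partial>lebesgue) \<le> 1"
  proof -
    have "(\<integral>\<^sup>+x. ennreal ((f x * w x) powr p x) \<partial>lebesgue) \<le> (\<integral>\<^sup>+x. ennreal (1 * u x powr q x / r) \<partial>lebesgue)"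
    proof (rule nn_integral_mono_AE)
      show "AE x in lebesgue. ennreal ((f x * w x) powr p x) \<le> ennreal (1 * u x powr q x / r)"
        using regular
      proof eventually_elim
        case (elim x)
        have "(f x * w x) powr p x = (u x powr (q x - 1) / r) powr p x"
          using elim by (simp add: f_def)
        also have "\<dots> = u x powr q x / r powr p x"
          using r1 elim by (simp add: powr_divide powr_powr conj_identities(2))
        also have "\<dots> \<le> u x powr q x / r"
          using r1 elim powr_mono[of 1 "p x" r] by (intro divide_left_mono) auto
        finally show ?case by (simp add: ennreal_leI)
      qed
    qed
    then show ?thesis using scaled[of 1] by simp
  qed
  have fQ: "(\<integral>\<^sup>+x\<in>core S Q. ennreal (f x) \<partial>lebesgue) < \<infinity>" if Q: "Q \<in> S" for Q
  proof -
    have "(\<integral>\<^sup>+x\<in>core S Q. ennreal (f x) \<partial>lebesgue) \<le>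
        (\<integral>\<^sup>+x\<in>core S Q. (ennreal ((f x * w x) powr p x) + ennreal ((1 / w x) powr q x)) \<partial>lebesgue)"
    proof (rule AE_core_mono, intro AE_I2 impI)
      fix x assume x: "0 < w x \<and> 1 < p x \<and> p x \<le> P \<and> q x \<le> P"
      have "f x = f x * w x * (1 / w x)" using x by simp
      also have "\<dots> \<le> (f x * w x) powr p x + (1 / w x) powr q x"
        using x f0[of x] by (intro young) auto
      finally show "ennreal (f x) \<le> ennreal ((f x * w x) powr p x) + ennreal ((1 / w x) powr q x)"
        by (simp add: ennreal_plus[symmetric] ennreal_leI del: ennreal_plus)
    qed
    also have "\<dots> = (\<integral>\<^sup>+x\<in>core S Q. ennreal ((f x * w x) powr p x) \<partial>lebesgue) +
        (\<integral>\<^sup>+x\<in>core S Q. ennreal ((1 / w x) powr q x) \<partial>lebesgue)"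
      using Q by (subst nn_integral_add[symmetric]) (auto simp: distrib_right)
    also have "\<dots> < \<infinity>"
    proof -
      have "(\<integral>\<^sup>+x\<in>core S Q. ennreal ((f x * w x) powr p x) \<partial>lebesgue) \<le>
          (\<integral>\<^sup>+x. ennreal ((f x * w x) powr p x) \<partial>lebesgue)"
        by (intro nn_integral_mono) (auto simp: indicator_def)
      also have "\<dots> < \<infinity>" using f1 by (simp add: order.strict_trans1[OF _ ennreal_one_less_top])
      finally show ?thesis using core_integral_finite(2)[OF Q, of 1] by (simp add: ennreal_add_less_top)
    qed
    finally show ?thesis .
  qed
  define F where "F Q = enn2real (\<integral>\<^sup>+x\<in>core S Q. ennreal (f x) \<partial>lebesgue)" for Q
  have F: "ennreal (F Q) = (\<integral>\<^sup>+x\<in>core S Q. ennreal (f x) \<partial>lebesgue)" if "Q \<in> S" for Q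
    using fQ[OF that] by (simp add: F_def)
  have F0: "0 \<le> F Q" for Q by (simp add: F_def)
  \<comment> \<open>The adjoint of sparse averaging: the part of \<open>f\<close> on E(Q), averaged
    over all of Q. Hence \<alpha>_Q times the integral of \<open>g\<close> over Q equals
    \<open>a Q * F Q\<close>, while the step function of \<alpha> stays below
    \<open>M f\<close>.\<close>
  define \<alpha> where "\<alpha> Q = F Q / measure lebesgue Q" for Q
  have \<alpha>0: "0 \<le> \<alpha> Q" for Q using F0[of Q] by (simp add: \<alpha>_def)
  have below: "ennreal (step S \<alpha> x) \<le> maximal_op f x" for x
  proof (cases "\<exists>Q\<in>S. x \<in> core S Q")
    case True
    then obtain Q where Q: "Q \<in> S" "x \<in> core S Q" by blast
    have "ennreal (\<alpha> Q) = ennreal (F Q) / ennreal (measure lebesgue Q)"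
      unfolding \<alpha>_def using F0 volume(2)[OF Q(1)] by (simp add: divide_ennreal)
    also have "\<dots> \<le> average Q (\<lambda>y. ennreal \<bar>f y\<bar>)"
      unfolding volume(3)[OF Q(1)] F[OF Q(1)] using core_subset[of S Q] f0
      by (intro divide_right_mono_ennreal nn_integral_mono) (auto simp: indicator_def)
    also have "\<dots> \<le> maximal_op f x" using Q core_subset[of S Q] by (intro average_le_maximal_op) auto
    finally show ?thesis using step_core[OF fin lam Q] by simp
  qed (simp add: step_outside)
  have "(\<integral>\<^sup>+x. ennreal ((step S \<alpha> x / C * w x) powr p x) \<partial>lebesgue) \<le> 1"
    using \<alpha>0 by (intro maximal_bound_minorant[OF f_meas f0 f1 _ below] step_nonneg)
  moreover have "step S \<alpha> x / C = step S (\<lambda>Q. \<alpha> Q / C) x" for x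
    by (simp add: step_def sum_divide_distrib)
  ultimately have "(\<Sum>Q\<in>S. \<phi> Q (\<alpha> Q / C)) \<le> 1"
    using modular_step[of "\<lambda>Q. \<alpha> Q / C"] \<alpha>0 C_ge_1 by simp
  then have "(\<Sum>Q\<in>S. \<alpha> Q / C * enn2real (\<integral>\<^sup>+x\<in>Q. ennreal (g x) \<partial>lebesgue)) \<le> carleson_const"
    using \<alpha>0 C_ge_1 by (intro carleson_pairing[OF g g0 g1]) auto
  also have "(\<Sum>Q\<in>S. \<alpha> Q / C * enn2real (\<integral>\<^sup>+x\<in>Q. ennreal (g x) \<partial>lebesgue)) = (\<Sum>Q\<in>S. a Q * F Q) / C"
    unfolding sum_divide_distrib
  proof (intro sum.cong refl)
    fix Q assume Q: "Q \<in> S"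
    show "\<alpha> Q / C * enn2real (\<integral>\<^sup>+x\<in>Q. ennreal (g x) \<partial>lebesgue) = a Q * F Q / C"
      unfolding avg[OF Q, symmetric] \<alpha>_def using volume(2)[OF Q] by simp
  qed
  also have "(\<Sum>Q\<in>S. a Q * F Q) = L"
  proof -
    have "ennreal (\<Sum>Q\<in>S. a Q * F Q) = (\<Sum>Q\<in>S. ennreal (a Q * F Q))"
      using a0 F0 by (intro sum_ennreal[symmetric]) auto
    also have "\<dots> = (\<Sum>Q\<in>S. \<integral>\<^sup>+x\<in>core S Q. (ennreal (a Q) * ennreal (f x)) \<partial>lebesgue)"
    proof (intro sum.cong refl)
      fix Q assume Q: "Q \<in> S"
      have "ennreal (a Q * F Q) = ennreal (a Q) * ennreal (F Q)"
        using F0 a0[OF Q] by (simp add: ennreal_mult)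
      also have "\<dots> = (\<integral>\<^sup>+x. ennreal (a Q) * (ennreal (f x) * indicator (core S Q) x) \<partial>lebesgue)"
        unfolding F[OF Q] using Q by (intro nn_integral_cmult[symmetric]) simp
      finally show "ennreal (a Q * F Q) = (\<integral>\<^sup>+x\<in>core S Q. (ennreal (a Q) * ennreal (f x)) \<partial>lebesgue)"
        by (simp add: mult.assoc)
    qed
    also have "\<dots> = (\<integral>\<^sup>+x. ennreal (step S a x) * ennreal (f x) \<partial>lebesgue)"
      by (rule nn_integral_step[OF fin lam S_sets, of "\<lambda>t x. ennreal t * ennreal (f x)", symmetric]) auto
    also have "\<dots> = (\<integral>\<^sup>+x. ennreal (L * u x powr q x / r) \<partial>lebesgue)"
    proof (rule nn_integral_cong_AE)
      show "AE x in lebesgue. ennreal (step S a x) * ennreal (f x) = ennreal (L * u x powr q x / r)"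
        using regular
      proof eventually_elim
        case (elim x)
        have "u x * u x powr (q x - 1) = u x powr q x"
        proof (cases "u x = 0")
          case False
          then show ?thesis using powr_mult_base[of "u x" "q x - 1"] u0[of x] by simp
        qed simp
        moreover have "step S a x = L * u x * w x" using L elim by (simp add: u_def)
        ultimately have "step S a x * f x = L * u x powr q x / r"
          using elim by (simp add: f_def field_simps)
        moreover have "0 \<le> step S a x" using a0 by (rule step_nonneg)
        ultimately show ?case using f0[of x] by (simp add: ennreal_mult[symmetric])
      qed
    qed
    also have "\<dots> = ennreal L" using L by (intro scaled) simp
    finally show ?thesis using L a0 F0 by (subst (asm) ennreal_inj) (auto intro!: sum_nonneg)
  qed
  finally have "2 * carleson_const \<le> carleson_const" using C_ge_1 by (simp add: L_def)
  then show False using carleson_const_pos by simp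
qed

end

section \<open>Sparse domination of the averages over a finite laminar family\<close>

context weighted_exponent
begin

text \<open>Outside its locale \<open>carleson_const\<close> takes only \<open>P\<close> and
  \<open>C\<close> as arguments, which records its independence of the family. The outer 2 is the
  loss in \<open>principal_sets\<close>.\<close>

abbreviation dual_const :: real where
  "dual_const \<equiv> 2 * (2 * sparse_family.carleson_const P C * C)"

text \<open>The majorant \<open>u\<close> is twice the step function of the means over the principal
  sets of \<open>D\<close>, which are sparse by \<open>core_large\<close>. Positivity of the
  constant is part of the conclusion because it is proved inside \<open>sparse_family\<close>, that
  is, for a given family.\<close>

lemma laminar_maximal:
  assumes D: "finite D" "laminar D" "\<And>Q. Q \<in> D \<Longrightarrow> \<exists>a l. 0 < l \<and> Q = hcube a l"
    and g [measurable]: "g \<in> borel_measurable lebesgue" and g0: "\<And>x. 0 \<le> g x"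
    and g1: "(\<integral>\<^sup>+x. ennreal ((g x / w x) powr q x) \<partial>lebesgue) \<le> 1"
  shows "0 < dual_const \<and> (\<exists>u\<in>borel_measurable lebesgue. (\<forall>x. 0 \<le> u x) \<and>
    (\<forall>Q\<in>D. \<forall>x\<in>Q. average Q (\<lambda>y. ennreal (g y)) \<le> ennreal (u x)) \<and>
    (\<integral>\<^sup>+x. ennreal ((u x / dual_const / w x) powr q x) \<partial>lebesgue) \<le> 1)"
proof -
  define a where "a Q = enn2real (average Q (\<lambda>y. ennreal (g y)))" for Q
  have a0: "0 \<le> a Q" for Q by (simp add: a_def)
  have D_sets: "D \<subseteq> sets lebesgue" using D(3) by force
  have fing: "(\<integral>\<^sup>+x. ennreal ((g x / w x) powr q x) \<partial>lebesgue) < \<infinity>"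
    using order.strict_trans1[OF g1 ennreal_one_less_top] by simp
  have intQ: "(\<integral>\<^sup>+x\<in>Q. ennreal (g x) \<partial>lebesgue) < \<infinity>" if "Q \<in> D" for Q
    using D(3)[OF that] integrable_on_hcube[OF g g0 fing] by blast
  have vol: "\<exists>v>0. emeasure lebesgue Q = ennreal v" if "Q \<in> D" for Q
    using D(3)[OF that] emeasure_hcube(1) by (metis less_imp_le zero_less_power)
  have avg: "ennreal (a Q) * emeasure lebesgue Q = (\<integral>\<^sup>+x\<in>Q. ennreal (g x) \<partial>lebesgue)"
      "average Q (\<lambda>y. ennreal (g y)) = ennreal (a Q)" if Q: "Q \<in> D" for Q
  proof -
    obtain v where v: "0 < v" "emeasure lebesgue Q = ennreal v" using vol[OF Q] by blast
    obtain I where I: "0 \<le> I" "(\<integral>\<^sup>+x\<in>Q. ennreal (g x) \<partial>lebesgue) = ennreal I"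
      using intQ[OF Q] by (cases "\<integral>\<^sup>+x\<in>Q. ennreal (g x) \<partial>lebesgue") auto
    have *: "average Q (\<lambda>y. ennreal (g y)) = ennreal (I / v)"
      unfolding average_def I v using I v by (simp add: divide_ennreal)
    then have "a Q = I / v" using I v by (simp add: a_def)
    then show "ennreal (a Q) * emeasure lebesgue Q = (\<integral>\<^sup>+x\<in>Q. ennreal (g x) \<partial>lebesgue)"
      "average Q (\<lambda>y. ennreal (g y)) = ennreal (a Q)"
      unfolding I v * using I v by (simp_all add: ennreal_mult[symmetric])
  qed
  obtain S where SD: "S \<subseteq> D" and S1: "\<forall>R\<in>D. \<exists>Q\<in>S. R \<subseteq> Q \<and> a R \<le> 2 * a Q"
    and S2: "\<forall>Q\<in>S. \<forall>R\<in>S. R \<subset> Q \<longrightarrow> 2 * a Q < a R"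
    using principal_sets[OF D(1), of a] a0 by blast
  have S: "finite S" "laminar S" "S \<subseteq> sets lebesgue"
    using SD D finite_subset laminar_subset D_sets by auto
  interpret sparse_family p w P C S
  proof
    show "\<exists>a l. 0 < l \<and> Q = hcube a l" if "Q \<in> S" for Q using D(3) SD that by blast
    show "emeasure lebesgue Q \<le> 2 * emeasure lebesgue (core S Q)" if Q: "Q \<in> S" for Q
    proof (rule core_large[OF S Q, where a = a])
      show "emeasure lebesgue Q < \<infinity>" using vol[OF subsetD[OF SD Q]] by auto
      show "emeasure lebesgue R \<noteq> 0" if "R \<in> S" for R using vol[OF subsetD[OF SD that]] by auto
      show "2 * a Q < a R" if "R \<in> S" "R \<subset> Q" for R using S2 Q that by blast
    qed (use Q SD intQ avg a0 in auto)
  qed (use S in auto)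
  define u where "u x = 2 * step S a x" for x
  have "average R (\<lambda>y. ennreal (g y)) \<le> ennreal (u x)" if R: "R \<in> D" "x \<in> R" for R x
  proof -
    obtain Q where Q: "Q \<in> S" "R \<subseteq> Q" "a R \<le> 2 * a Q" using S1 R by blast
    \<comment> \<open>The least principal set containing \<open>x\<close>, where the step function
      is evaluated. It lies inside \<open>Q\<close>, and going down among principal sets only raises
      the mean.\<close>
    obtain T where T: "T \<in> S" "x \<in> core S T" "T \<subseteq> Q"
      using core_exists[OF S(1,2) Q(1), of x] Q R by (metis subsetD)
    have "a Q \<le> a T"
    proof (cases "T = Q")
      case False
      then have "2 * a Q < a T" using S2 Q(1) T by blast
      then show ?thesis using a0[of Q] by simp
    qed simp
    then have "a R \<le> u x" using Q(3) step_core[OF S(1,2) T(1,2)] by (simp add: u_def)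
    then show ?thesis using avg(2)[OF R(1)] by (simp add: ennreal_leI)
  qed
  moreover have "(\<integral>\<^sup>+x. ennreal ((u x / dual_const / w x) powr q x) \<partial>lebesgue) \<le> 1"
  proof -
    have "u x / dual_const = step S a x / (2 * carleson_const * C)" for x by (simp add: u_def)
    moreover have "a Q * measure lebesgue Q = enn2real (\<integral>\<^sup>+x\<in>Q. ennreal (g x) \<partial>lebesgue)" if "Q \<in> S" for Q
    proof -
      have "ennreal (a Q * measure lebesgue Q) = (\<integral>\<^sup>+x\<in>Q. ennreal (g x) \<partial>lebesgue)"
        using avg(1)[OF subsetD[OF SD that]] a0[of Q] unfolding volume(1)[OF that]
        by (simp add: ennreal_mult)
      then show ?thesis using a0[of Q] by (metis enn2real_ennreal measure_nonneg mult_nonneg_nonneg)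
    qed
    ultimately show ?thesis using dual_bound[OF g g0 g1, of a] a0 by simp
  qed
  moreover have "0 \<le> u x" for x unfolding u_def using step_nonneg[of S a x] a0 by simp
  moreover have "u \<in> borel_measurable lebesgue" unfolding u_def[abs_def] by measurable
  moreover have "0 < dual_const" using carleson_const_pos C_ge_1 by simp
  ultimately show ?thesis by blast
qed

end

section \<open>Shifted dyadic grids\<close>

definition dyadic_cube :: "nat \<Rightarrow> real^'n \<Rightarrow> nat \<Rightarrow> ('n \<Rightarrow> int) \<Rightarrow> (real^'n) set" where
  "dyadic_cube N t j m = hcube (\<chi> i. t $ i + 2 ^ N / 2 ^ j * of_int (m i)) (2 ^ N / 2 ^ j)"

text \<open>Meshes from 2^N down to 2^(-N). The bound on the indices keeps the family finite, yet
  lets it reach any fixed bounded region once N is large.\<close>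

definition grid :: "nat \<Rightarrow> real^'n \<Rightarrow> (real^'n) set set" where
  "grid N t = (\<lambda>(j, m). dyadic_cube N t j m) ` ({..2 * N} \<times> {m. \<forall>i. m i \<in> {- (4 ^ (N + 1))..4 ^ (N + 1)}})"

lemma mem_dyadic_cube:
  "x \<in> dyadic_cube N t j m \<longleftrightarrow> (\<forall>i. \<lfloor>(x $ i - t $ i) / (2 ^ N / 2 ^ j)\<rfloor> = m i)"
  unfolding dyadic_cube_def hcube_def mem_Collect_eq
proof (intro iff_allI)
  fix i
  define s :: real where "s = 2 ^ N / 2 ^ j"
  have s: "0 < s" by (simp add: s_def)
  have "\<lfloor>(x $ i - t $ i) / s\<rfloor> = m i \<longleftrightarrow> of_int (m i) * s \<le> x $ i - t $ i \<and> x $ i - t $ i < (of_int (m i) + 1) * s"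
    using s by (simp add: floor_eq_iff pos_le_divide_eq pos_divide_less_eq)
  then show "((\<chi> i. t $ i + 2 ^ N / 2 ^ j * of_int (m i)) $ i \<le> x $ i \<and>
       x $ i < (\<chi> i. t $ i + 2 ^ N / 2 ^ j * of_int (m i)) $ i + 2 ^ N / 2 ^ j) \<longleftrightarrow>
      \<lfloor>(x $ i - t $ i) / (2 ^ N / 2 ^ j)\<rfloor> = m i"
    unfolding s_def[symmetric] by (auto simp: algebra_simps)
qed

lemma dyadic_cube_nested:
  assumes "j \<le> j'" "x \<in> dyadic_cube N t j m" "x \<in> dyadic_cube N t j' m'"
  shows "dyadic_cube N t j' m' \<subseteq> dyadic_cube N t j m"
proof
  fix y assume y: "y \<in> dyadic_cube N t j' m'"
  \<comment> \<open>The coarse index is the fine index divided by a power of 2 and rounded down; so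
    points sharing a fine cube share every coarser cube.\<close>
  have coarse: "\<lfloor>z / (2 ^ N / 2 ^ j)\<rfloor> = \<lfloor>z / (2 ^ N / 2 ^ j')\<rfloor> div 2 ^ (j' - j)" for z :: real
  proof -
    have "(2::real) ^ j' = 2 ^ j * 2 ^ (j' - j)" using assms(1) by (simp add: power_add[symmetric])
    then have "z / (2 ^ N / 2 ^ j) = z / (2 ^ N / 2 ^ j') / real_of_int (2 ^ (j' - j))"
      by (simp add: field_simps)
    then show ?thesis by (simp only: floor_divide_real_eq_div[of "2 ^ (j' - j)"] zero_le_power zero_le_numeral)
  qed
  show "y \<in> dyadic_cube N t j m"
    using assms(2,3) y unfolding mem_dyadic_cube coarse by simp
qed

lemma grid_laminar: "laminar (grid N t)"
  unfolding laminar_def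
proof (intro ballI)
  fix Q R assume "Q \<in> grid N t" "R \<in> grid N t"
  then obtain j m j' m' where Q: "Q = dyadic_cube N t j m" and R: "R = dyadic_cube N t j' m'"
    by (auto simp: grid_def)
  show "Q \<inter> R = {} \<or> Q \<subseteq> R \<or> R \<subseteq> Q"
  proof (cases "Q \<inter> R = {}")
    case False
    then obtain x where x: "x \<in> Q" "x \<in> R" by blast
    show ?thesis
    proof (cases "j \<le> j'")
      case True
      then show ?thesis using dyadic_cube_nested[OF True] x Q R by blast
    next
      case False
      then show ?thesis using dyadic_cube_nested[of j' j] x Q R by (metis nat_le_linear)
    qed
  qed simp
qed

lemma grid_finite:
  fixes t :: "real^'n"
  shows "finite (grid N t)"
proof -
  have "finite (PiE UNIV (\<lambda>_::'n. {- (4 ^ (N + 1))..4 ^ (N + 1) :: int}))"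
    by (intro finite_PiE) auto
  then have "finite {m :: 'n \<Rightarrow> int. \<forall>i. m i \<in> {- (4 ^ (N + 1))..4 ^ (N + 1)}}"
    by (simp add: PiE_UNIV_domain Pi_def)
  then show ?thesis unfolding grid_def by blast
qed

lemma grid_cubes: "Q \<in> grid N t \<Longrightarrow> \<exists>a l. 0 < l \<and> Q = hcube a l"
proof -
  assume "Q \<in> grid N t"
  then obtain j m where "Q = dyadic_cube N t j m" by (auto simp: grid_def)
  then have "0 < (2::real) ^ N / 2 ^ j \<and> Q = hcube (\<chi> i. t $ i + 2 ^ N / 2 ^ j * of_int (m i)) (2 ^ N / 2 ^ j)"
    by (simp add: dyadic_cube_def)
  then show ?thesis by blast
qed

text \<open>The grid points of the two grids are at least a third of the mesh apart since 3 does not divide a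
  power of 2; hence a short interval cannot contain grid points of both.\<close>

lemma one_third_trick:
  fixes a l s :: real
  assumes s: "s = 2 ^ N / 2 ^ j" and l: "0 < l" "3 * l < s"
  shows "\<exists>\<tau>\<in>{0, 2 ^ N / 3}. \<exists>m::int. \<tau> + s * of_int m \<le> a \<and> a + l < \<tau> + s * (of_int m + 1)"
proof (rule ccontr)
  assume neg: "\<not> ?thesis"
  have s0: "0 < s" by (simp add: s)
  \<comment> \<open>If no grid interval contains the short one, the first grid point after
    \<open>a\<close> falls into it, for both shifts.\<close>
  have straddle: "a < \<tau> + s * (of_int \<lfloor>(a - \<tau>) / s\<rfloor> + 1) \<and> \<tau> + s * (of_int \<lfloor>(a - \<tau>) / s\<rfloor> + 1) \<le> a + l"
    if \<tau>: "\<tau> \<in> {0, 2 ^ N / 3}" for \<tau>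
  proof -
    let ?m = "\<lfloor>(a - \<tau>) / s\<rfloor>"
    have "of_int ?m \<le> (a - \<tau>) / s" "(a - \<tau>) / s < of_int ?m + 1" by linarith+
    then have "of_int ?m * s \<le> a - \<tau>" "a - \<tau> < (of_int ?m + 1) * s"
      by (simp_all only: pos_le_divide_eq[OF s0] pos_divide_less_eq[OF s0])
    then have "\<tau> + s * of_int ?m \<le> a" "a < \<tau> + s * (of_int ?m + 1)"
      by (simp_all only: mult.commute[of s])
    then show ?thesis using neg \<tau> by (meson linorder_not_le)
  qed
  define m0 m1 where "m0 = \<lfloor>a / s\<rfloor>" and "m1 = \<lfloor>(a - 2 ^ N / 3) / s\<rfloor>"
  have 1: "a < s * (of_int m0 + 1)" "s * (of_int m0 + 1) \<le> a + l"
    using straddle[of 0] by (auto simp: m0_def)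
  have 2: "a < 2 ^ N / 3 + s * (of_int m1 + 1)" "2 ^ N / 3 + s * (of_int m1 + 1) \<le> a + l"
    using straddle[of "2 ^ N / 3"] by (auto simp: m1_def)
  have N: "2 ^ N = s * 2 ^ j" by (simp add: s)
  \<comment> \<open>In units of the mesh the shift is 2^j / 3. Two grid points closer than a third
    of the mesh leave \<open>3 * (m0 - m1) - 2 ^ j\<close> strictly between -1 and 1, hence equal to
    0.\<close>
  have "s * (3 * (of_int m0 - of_int m1) - 2 ^ j) < s * 1" "s * (-1) < s * (3 * (of_int m0 - of_int m1) - 2 ^ j)"
    using 1 2 l unfolding N by (simp_all add: algebra_simps)
  then have "3 * (of_int m0 - of_int m1) - 2 ^ j < (1::real)" "-1 < 3 * (of_int m0 - of_int m1) - (2::real) ^ j"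
    using s0 by (simp_all only: mult_less_cancel_left_pos)
  then have "real_of_int (3 * (m0 - m1) - 2 ^ j) < real_of_int 1" "real_of_int (-1) < real_of_int (3 * (m0 - m1) - 2 ^ j)"
    by simp_all
  then have "3 * (m0 - m1) = 2 ^ j" unfolding of_int_less_iff by simp
  then have "(3::int) dvd 2 ^ j" by (metis dvd_triv_left)
  moreover have "coprime (3::int) (2 ^ j)" by simp
  ultimately have "is_unit (3::int)" by (metis coprime_def dvd_refl)
  then show False by simp
qed

text \<open>One shift for each subset of the coordinates, so 2^n grids in dimension n. Modulo the
  mesh, 2^N / 3 is one or two thirds of it at every scale of the grid.\<close>

definition grid_shift :: "nat \<Rightarrow> 'n set \<Rightarrow> real^'n" where
  "grid_shift N A = (\<chi> i. if i \<in> A then 2 ^ N / 3 else 0)"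

text \<open>The mesh \<open>s\<close> is the largest power of 2 up to \<open>6 * l\<close>, hence
  above \<open>3 * l\<close>, and the one-third trick applies in each coordinate separately. The
  shifts move with N, so the grids need not increase with N; the containing cube is found anew for
  each large N.\<close>

lemma cube_in_grid:
  fixes a :: "real^'n"
  assumes l: "0 < l"
  shows "\<forall>\<^sub>F N in sequentially. \<exists>A b s. 0 < s \<and> s \<le> 6 * l \<and> hcube b s \<in> grid N (grid_shift N A) \<and>
    cbox a (\<chi> i. a $ i + l) \<subseteq> hcube b s"
proof -
  define k where "k = \<lfloor>log 2 (6 * l)\<rfloor>"
  define s :: real where "s = 2 powr of_int k"
  have s0: "0 < s" by (simp add: s_def)
  have "2 powr of_int k \<le> 2 powr log 2 (6 * l)" unfolding k_def by (intro powr_mono) auto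
  then have s6: "s \<le> 6 * l" using l by (simp add: s_def)
  have "2 powr log 2 (6 * l) < 2 powr (of_int k + 1)" unfolding k_def by (intro powr_less_mono) linarith+
  then have s3: "3 * l < s" using l by (simp add: s_def powr_add)
  have "\<forall>\<^sub>F N in sequentially. \<forall>i. \<bar>a $ i\<bar> \<le> real N"
    by (intro eventually_all_finite) (simp add: eventually_at_top_linorder[of "\<lambda>N. _ \<le> real N"], meson order.trans of_nat_le_iff real_arch_simple)
  moreover have "\<forall>\<^sub>F N in sequentially. nat \<bar>k\<bar> \<le> N" by (rule eventually_ge_at_top)
  ultimately show ?thesis
  proof eventually_elim
    case (elim N)
    define j where "j = nat (int N - k)"
    have j: "j \<le> 2 * N" "int j = int N - k" using elim(2) by (auto simp: j_def)
    have sj: "s = 2 ^ N / 2 ^ j"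
    proof -
      have "of_int k = real N - real j" using j(2) by linarith
      then show ?thesis by (simp add: s_def powr_diff powr_realpow)
    qed
    have "\<forall>i. \<exists>\<tau>. \<exists>m::int. \<tau> \<in> {0, 2 ^ N / 3} \<and> \<tau> + s * of_int m \<le> a $ i \<and> a $ i + l < \<tau> + s * (of_int m + 1)"
      using one_third_trick[OF sj l s3] by blast
    then obtain \<tau> m where \<tau>: "\<And>i. \<tau> i \<in> {0, 2 ^ N / 3}"
      and m: "\<And>i. \<tau> i + s * of_int (m i :: int) \<le> a $ i" "\<And>i. a $ i + l < \<tau> i + s * (of_int (m i) + 1)"
      by metis
    define A where "A = {i. \<tau> i \<noteq> 0}"
    have shift: "grid_shift N A $ i = \<tau> i" for i using \<tau>[of i] by (auto simp: grid_shift_def A_def)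
    define b where "b = (\<chi> i. grid_shift N A $ i + 2 ^ N / 2 ^ j * of_int (m i))"
    have cube: "hcube b s = dyadic_cube N (grid_shift N A) j m"
      by (simp add: dyadic_cube_def b_def sj)
    \<comment> \<open>Coordinates are at most N \<le> 2^N in size, the shift is at most 2^N, and the
      mesh is at least 2^(-N): the index is of order 4^N, and the exponent N + 1 leaves the needed
      room.\<close>
    have "m i \<in> {- (4 ^ (N + 1))..4 ^ (N + 1)}" for i
    proof -
      have N1: "real N \<le> 2 ^ N" by (metis less_imp_le of_nat_less_two_power)
      have \<tau>N: "0 \<le> \<tau> i" "\<tau> i \<le> 2 ^ N" 
      proof -
        have "\<tau> i = 0 \<or> \<tau> i = 2 ^ N / 3" using \<tau>[of i] by blast
        moreover have "(0::real) \<le> 2 ^ N" by simp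
        ultimately have "0 \<le> \<tau> i \<and> \<tau> i \<le> 2 ^ N" by linarith
        then show "0 \<le> \<tau> i" "\<tau> i \<le> 2 ^ N" by auto
      qed
      have sN: "1 \<le> s * 2 ^ N"
      proof -
        have "(2::real) ^ j \<le> 2 ^ (2 * N)" using j(1) by (intro power_increasing) auto
        then show ?thesis by (simp add: sj mult_2 power_add)
      qed
      have up: "s * of_int (m i) \<le> 2 ^ N" using m(1)[of i] \<tau>N N1 spec[OF elim(1), of i] by linarith
      have lo: "- (2 * 2 ^ N) \<le> s * (of_int (m i) + 1)" using m(2)[of i] l \<tau>N N1 spec[OF elim(1), of i] by linarith
      have p4: "(4::real) ^ N = 2 ^ N * 2 ^ N" by (simp add: power_mult_distrib[symmetric])
      have "real_of_int (m i) \<le> 4 ^ N"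
      proof (cases "0 \<le> m i")
        case True
        have "real_of_int (m i) \<le> s * 2 ^ N * of_int (m i)" using sN True by (simp add: mult_le_cancel_right1)
        also have "\<dots> \<le> 2 ^ N * 2 ^ N" using mult_right_mono[OF up, of "2 ^ N"] by (simp add: mult_ac)
        finally show ?thesis by (simp add: p4)
      next
        case False
        then have "real_of_int (m i) \<le> 0" by simp
        then show ?thesis by (rule order.trans) simp
      qed
      moreover have "- (2 * 4 ^ N) \<le> real_of_int (m i) + 1"
      proof (cases "0 \<le> m i + 1")
        case True
        then have "0 \<le> real_of_int (m i) + 1" by linarith
        then show ?thesis by (rule order.trans[rotated]) simp
      next
        case False
        then have "real_of_int (m i) + 1 \<le> 0" by linarith
        then have "real_of_int (m i) + 1 \<ge> s * 2 ^ N * (real_of_int (m i) + 1)"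
          using mult_right_mono_neg[OF sN] by simp
        moreover have "s * 2 ^ N * (real_of_int (m i) + 1) \<ge> - (2 * 2 ^ N) * 2 ^ N"
          using mult_right_mono[OF lo, of "2 ^ N"] by (simp add: mult_ac)
        ultimately show ?thesis by (simp add: p4)
      qed
      moreover have "(1::real) \<le> 4 ^ N" by simp
      ultimately have "- (4 * 4 ^ N) \<le> real_of_int (m i)" "real_of_int (m i) \<le> 4 * 4 ^ N" by linarith+
      then have "real_of_int (- (4 * 4 ^ N)) \<le> real_of_int (m i)" "real_of_int (m i) \<le> real_of_int (4 * 4 ^ N)"
        by simp_all
      then show ?thesis unfolding of_int_le_iff by simp
    qed
    then have "hcube b s \<in> grid N (grid_shift N A)"
      unfolding cube grid_def using j(1) by (intro image_eqI[of _ _ "(j, m)"]) auto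
    moreover have "cbox a (\<chi> i. a $ i + l) \<subseteq> hcube b s"
    proof
      fix x assume x: "x \<in> cbox a (\<chi> i. a $ i + l)"
      show "x \<in> hcube b s"
        unfolding hcube_def b_def sj[symmetric]
      proof (intro CollectI allI conjI)
        fix i
        have "a $ i \<le> x $ i" "x $ i \<le> a $ i + l" using x by (auto simp: mem_box_cart)
        then show "(\<chi> i. grid_shift N A $ i + s * of_int (m i)) $ i \<le> x $ i"
          "x $ i < (\<chi> i. grid_shift N A $ i + s * of_int (m i)) $ i + s"
          using m[of i] by (simp_all add: shift algebra_simps)
      qed
    qed
    ultimately show ?case using s0 s6 by blast
  qed
qed

section \<open>The dual bound\<close>

context weighted_exponent
begin

text \<open>The factor 6^n compares a cube with the grid cube around it, and
  \<open>dual_const\<close> belongs to a single grid. The modulars of the 2^n grids add up to at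
  most 2^n; dividing the function by 2^n brings this back to 1 because q > 1.\<close>

definition dual_bound_const :: real where
  "dual_bound_const = 6 ^ CARD('n) * (2 ^ CARD('n) * dual_const)"

lemma dual_const_pos: "0 < dual_const"
  by (rule conjunct1[OF laminar_maximal[of "{}" "\<lambda>_. 0"]]) (auto simp: laminar_def)

lemma dual_bound_const_pos: "0 < dual_bound_const"
  unfolding dual_bound_const_def
  using mult_pos_pos[OF _ mult_pos_pos[OF _ dual_const_pos], of "6 ^ CARD('n)" "2 ^ CARD('n)"] by simp

text \<open>The majorants for different N are unrelated, so monotone convergence is not at hand;
  Fatou's lemma is applied to the liminf \<open>Z\<close> of their modular densities. At a fixed
  point every cube through it is caught by some grid for all large N, so its mean is controlled by
  \<open>Z\<close> there.\<close>

theorem dual_maximal: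
  assumes f: "f \<in> borel_measurable lebesgue"
    and f1: "(\<integral>\<^sup>+x. ennreal ((\<bar>f x\<bar> / w x) powr q x) \<partial>lebesgue) \<le> 1"
  shows "modular q (\<lambda>x. maximal_op f x * inverse (ennreal (w x)) / ennreal dual_bound_const) \<le> 1"
proof -
  note [measurable] = f
  define n where "n = CARD('n)"
  define \<Lambda> where "\<Lambda> = dual_const"
  have \<Lambda>: "0 < \<Lambda>" unfolding \<Lambda>_def by (rule dual_const_pos)
  have K: "dual_bound_const = 6 ^ n * (2 ^ n * \<Lambda>)" by (simp add: dual_bound_const_def \<Lambda>_def n_def)
  define good where "good N A v \<longleftrightarrow> v \<in> borel_measurable lebesgue \<and> (\<forall>x. 0 \<le> v x) \<and>
      (\<forall>Q\<in>grid N (grid_shift N A). \<forall>x\<in>Q. average Q (\<lambda>y. ennreal \<bar>f y\<bar>) \<le> ennreal (v x)) \<and>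
      (\<integral>\<^sup>+x. ennreal ((v x / \<Lambda> / w x) powr q x) \<partial>lebesgue) \<le> 1" for N A and v :: "real^'n \<Rightarrow> real"
  define u where "u N A = (SOME v. good N A v)" for N A
  have good: "good N A (u N A)" for N A
  proof -
    have "\<exists>v\<in>borel_measurable lebesgue. (\<forall>x. 0 \<le> v x) \<and>
      (\<forall>Q\<in>grid N (grid_shift N A). \<forall>x\<in>Q. average Q (\<lambda>y. ennreal \<bar>f y\<bar>) \<le> ennreal (v x)) \<and>
      (\<integral>\<^sup>+x. ennreal ((v x / dual_const / w x) powr q x) \<partial>lebesgue) \<le> 1"
      using f1 by (intro conjunct2[OF laminar_maximal] grid_finite grid_laminar grid_cubes) auto
    then have "\<exists>v. good N A v" unfolding good_def \<Lambda>_def by (simp only: Bex_def)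
    then show ?thesis unfolding u_def by (rule someI_ex)
  qed
  have u_meas [measurable]: "u N A \<in> borel_measurable lebesgue" for N A
    using good[of N A] unfolding good_def by (elim conjE)
  have u0: "0 \<le> u N A x" for N A x using good[of N A] unfolding good_def by (elim conjE allE)
  have u_avg: "average Q (\<lambda>y. ennreal \<bar>f y\<bar>) \<le> ennreal (u N A x)"
    if "Q \<in> grid N (grid_shift N A)" "x \<in> Q" for N A Q x
    using good[of N A] that unfolding good_def by (elim conjE) (drule (1) bspec, drule (1) bspec)
  have u1: "(\<integral>\<^sup>+x. ennreal ((u N A x / \<Lambda> / w x) powr q x) \<partial>lebesgue) \<le> 1" for N A
    using good[of N A] unfolding good_def by (elim conjE)
  \<comment> \<open>The grid that catches a given cube may change with N; the sum over all shifts
    dominates whichever one does.\<close>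
  define F where "F N x = (\<Sum>A\<in>UNIV. (u N A x / \<Lambda> / w x) powr q x)" for N x
  have F_meas [measurable]: "F N \<in> borel_measurable lebesgue" for N
    unfolding F_def[abs_def] by measurable
  have F1: "(\<integral>\<^sup>+x. ennreal (F N x) \<partial>lebesgue) \<le> ennreal (2 ^ n)" for N
  proof -
    have "(\<integral>\<^sup>+x. ennreal (F N x) \<partial>lebesgue) =
        (\<integral>\<^sup>+x. (\<Sum>A\<in>UNIV. ennreal ((u N A x / \<Lambda> / w x) powr q x)) \<partial>lebesgue)"
      unfolding F_def by simp
    also have "\<dots> = (\<Sum>A\<in>UNIV. \<integral>\<^sup>+x. ennreal ((u N A x / \<Lambda> / w x) powr q x) \<partial>lebesgue)"
      by (intro nn_integral_sum) measurable
    also have "\<dots> \<le> (\<Sum>A\<in>(UNIV::'n set set). 1)" by (intro sum_mono u1)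
    also have "\<dots> = ennreal (2 ^ n)"
      using ennreal_power[of 2 n] by (simp add: n_def card_UNIV_set)
    finally show ?thesis .
  qed
  define Z where "Z x = liminf (\<lambda>N. ennreal (F N x))" for x
  have Z1: "(\<integral>\<^sup>+x. Z x \<partial>lebesgue) \<le> ennreal (2 ^ n)"
  proof -
    have "(\<integral>\<^sup>+x. Z x \<partial>lebesgue) \<le> liminf (\<lambda>N. \<integral>\<^sup>+x. ennreal (F N x) \<partial>lebesgue)"
      unfolding Z_def by (rule nn_integral_liminf) simp
    also have "\<dots> \<le> ennreal (2 ^ n)" using F1 by (intro Liminf_le) auto
    finally show ?thesis .
  qed
  have cube: "\<exists>c. 0 \<le> c \<and> average Q (\<lambda>y. ennreal \<bar>f y\<bar>) = ennreal (6 ^ n * c) \<and>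
      ennreal ((c / \<Lambda> / w x) powr q x) \<le> Z x"
    if Q: "Q \<in> cubes" "x \<in> Q" and x: "0 < w x" "1 < p x" for Q :: "(real^'n) set" and x
  proof -
    obtain a l where l: "0 < l" and Ql: "Q = cbox a (\<chi> i. a $ i + l)" using Q by (auto simp: cubes_def)
    have avg: "\<forall>\<^sub>F N in sequentially. \<exists>A. average Q (\<lambda>y. ennreal \<bar>f y\<bar>) \<le> ennreal (6 ^ n * u N A x)"
      using cube_in_grid[OF l, of a]
    proof eventually_elim
      case (elim N)
      then obtain A b s where s: "0 < s" "s \<le> 6 * l" and R: "hcube b s \<in> grid N (grid_shift N A)"
        and sub: "Q \<subseteq> hcube b s" unfolding Ql by blast
      let ?I = "\<integral>\<^sup>+y\<in>hcube b s. ennreal \<bar>f y\<bar> \<partial>lebesgue"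
      have vols: "s ^ n \<le> 6 ^ n * l ^ n"
        using power_mono[OF s(2), of n] s(1) by (simp add: power_mult_distrib)
      have "average Q (\<lambda>y. ennreal \<bar>f y\<bar>) \<le> ?I / ennreal (l ^ n)"
        unfolding average_def Ql emeasure_hcube(2)[OF less_imp_le[OF l]] n_def[symmetric]
        using sub unfolding Ql by (intro divide_right_mono_ennreal nn_integral_mono) (auto simp: indicator_def)
      also have "\<dots> \<le> ennreal (6 ^ n) * (?I / ennreal (s ^ n))"
      proof (cases ?I)
        case (real r)
        have "r / l ^ n \<le> 6 ^ n * (r / s ^ n)"
          using vols l s real mult_left_mono[OF vols, of r] by (simp add: field_simps)
        then show ?thesis unfolding real(2) using l s real(1)
          by (simp add: divide_ennreal ennreal_mult[symmetric] ennreal_leI)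
      next
        case top
        then show ?thesis using s by (simp add: ennreal_top_divide ennreal_mult_top)
      qed
      also have "?I / ennreal (s ^ n) = average (hcube b s) (\<lambda>y. ennreal \<bar>f y\<bar>)"
        unfolding average_def emeasure_hcube(1)[OF less_imp_le[OF s(1)]] n_def ..
      also have "ennreal (6 ^ n) * \<dots> \<le> ennreal (6 ^ n) * ennreal (u N A x)"
        using sub Q(2) by (intro mult_left_mono u_avg[OF R]) auto
      also have "\<dots> = ennreal (6 ^ n * u N A x)" using u0[of N A x] by (simp add: ennreal_mult)
      finally show ?case by blast
    qed
    have "\<exists>c\<ge>0. average Q (\<lambda>y. ennreal \<bar>f y\<bar>) = ennreal (6 ^ n * c)"
    proof -
      obtain N A where le: "average Q (\<lambda>y. ennreal \<bar>f y\<bar>) \<le> ennreal (6 ^ n * u N A x)"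
        using eventually_happens'[OF sequentially_bot avg] by blast
      then obtain v where "0 \<le> v" "average Q (\<lambda>y. ennreal \<bar>f y\<bar>) = ennreal v"
        by (cases "average Q (\<lambda>y. ennreal \<bar>f y\<bar>)") (auto simp: top_unique)
      then show ?thesis by (intro exI[of _ "v / 6 ^ n"]) simp
    qed
    then obtain c where c: "0 \<le> c" "average Q (\<lambda>y. ennreal \<bar>f y\<bar>) = ennreal (6 ^ n * c)" by blast
    have "\<forall>\<^sub>F N in sequentially. ennreal ((c / \<Lambda> / w x) powr q x) \<le> ennreal (F N x)"
      using avg
    proof eventually_elim
      case (elim N)
      then obtain A where "ennreal (6 ^ n * c) \<le> ennreal (6 ^ n * u N A x)" unfolding c(2) by blast
      then have "c \<le> u N A x" using u0[of N A x] by (subst (asm) ennreal_le_iff) auto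
      then have "(c / \<Lambda> / w x) powr q x \<le> (u N A x / \<Lambda> / w x) powr q x"
        using c(1) \<Lambda> x conj_identities(1)[of x] by (intro powr_mono2 divide_right_mono) auto
      also have "\<dots> \<le> F N x" unfolding F_def by (rule member_le_sum) auto
      finally show ?case by (rule ennreal_leI)
    qed
    then have "ennreal ((c / \<Lambda> / w x) powr q x) \<le> Z x" unfolding Z_def by (rule Liminf_bounded)
    then show ?thesis using c by blast
  qed
  have point: "epowr (maximal_op f x * inverse (ennreal (w x)) / ennreal dual_bound_const) (q x)
      \<le> ennreal (1 / 2 ^ n) * Z x" if x: "0 < w x" "1 < p x" for x
  proof (cases "Z x")
    case top
    then show ?thesis by (simp add: ennreal_mult_top)
  next
    case (real z)
    have q: "1 < q x" using conj_identities(1)[of x] x by simp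
    define b where "b = z powr (1 / q x) * w x * \<Lambda>"
    have b0: "0 \<le> b" using x \<Lambda> by (simp add: b_def)
    have "maximal_op f x \<le> ennreal (6 ^ n * b)"
      unfolding maximal_op_def
    proof (rule SUP_least)
      fix Q :: "(real^'n) set" assume "Q \<in> {Q \<in> cubes. x \<in> Q}"
      then obtain c where c: "0 \<le> c" "average Q (\<lambda>y. ennreal \<bar>f y\<bar>) = ennreal (6 ^ n * c)"
        "ennreal ((c / \<Lambda> / w x) powr q x) \<le> Z x" using cube[of Q x] x by blast
      have "(c / \<Lambda> / w x) powr q x \<le> z" using c(3) real by (simp add: ennreal_le_iff)
      then have "((c / \<Lambda> / w x) powr q x) powr (1 / q x) \<le> z powr (1 / q x)"
        using q by (intro powr_mono2) auto
      then have "c / \<Lambda> / w x \<le> z powr (1 / q x)" using q c(1) \<Lambda> x by (simp add: powr_powr)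
      then have "c \<le> b" using \<Lambda> x by (simp add: b_def field_simps)
      then show "average Q (\<lambda>y. ennreal \<bar>f y\<bar>) \<le> ennreal (6 ^ n * b)"
        unfolding c(2) by (intro ennreal_leI mult_left_mono) auto
    qed
    then have "maximal_op f x * inverse (ennreal (w x)) / ennreal dual_bound_const \<le>
        ennreal (6 ^ n * b) * inverse (ennreal (w x)) / ennreal dual_bound_const"
      by (intro divide_right_mono_ennreal mult_right_mono) auto
    also have "\<dots> = ennreal (6 ^ n * b / w x / dual_bound_const)"
      using x b0 dual_bound_const_pos
      by (simp add: inverse_ennreal ennreal_mult[symmetric] divide_ennreal divide_inverse)
    also have "6 ^ n * b / w x / dual_bound_const = z powr (1 / q x) / 2 ^ n"
      unfolding K b_def using x \<Lambda> by simp
    finally have "epowr (maximal_op f x * inverse (ennreal (w x)) / ennreal dual_bound_const) (q x) \<le>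
        epowr (ennreal (z powr (1 / q x) / 2 ^ n)) (q x)"
      using q by (intro epowr_mono) auto
    also have "\<dots> = ennreal ((z powr (1 / q x) / 2 ^ n) powr q x)"
      using q by (intro epowr_ennreal) auto
    also have "(z powr (1 / q x) / 2 ^ n) powr q x = z / (2 ^ n) powr q x"
      using q real(1) by (simp add: powr_divide powr_powr)
    also have "ennreal \<dots> \<le> ennreal (1 / 2 ^ n * z)"
    proof (rule ennreal_leI)
      have "(2 ^ n) powr 1 \<le> (2 ^ n :: real) powr q x" using q by (intro powr_mono) auto
      then have "z / (2 ^ n) powr q x \<le> z / 2 ^ n" using real(1) by (intro divide_left_mono) auto
      then show "z / (2 ^ n) powr q x \<le> 1 / 2 ^ n * z" by simp
    qed
    also have "\<dots> = ennreal (1 / 2 ^ n) * Z x" unfolding real(2) using real(1) by (intro ennreal_mult) auto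
    finally show ?thesis .
  qed
  have "modular q (\<lambda>x. maximal_op f x * inverse (ennreal (w x)) / ennreal dual_bound_const) \<le>
      (\<integral>\<^sup>+x. ennreal (1 / 2 ^ n) * Z x \<partial>lebesgue)"
    unfolding modular_def
  proof (rule nn_integral_mono_AE)
    show "AE x in lebesgue. epowr (maximal_op f x * inverse (ennreal (w x)) / ennreal dual_bound_const) (q x)
        \<le> ennreal (1 / 2 ^ n) * Z x"
      using regular by eventually_elim (rule point, auto)
  qed
  also have "\<dots> = ennreal (1 / 2 ^ n) * (\<integral>\<^sup>+x. Z x \<partial>lebesgue)"
    unfolding Z_def by (intro nn_integral_cmult) measurable
  also have "\<dots> \<le> ennreal (1 / 2 ^ n) * ennreal (2 ^ n)" by (intro mult_left_mono Z1) auto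
  also have "\<dots> = 1" by (simp add: ennreal_mult[symmetric])
  finally show ?thesis .
qed

end

section \<open>From norms to modulars and back; reduction of the hypotheses\<close>

lemma maximal_op_scale:
  assumes "f \<in> borel_measurable lebesgue" "0 < c"
  shows "maximal_op (\<lambda>y. f y / c) x = maximal_op f x / ennreal c"
proof -
  note [measurable] = assms(1)
  have "average Q (\<lambda>y. ennreal \<bar>f y / c\<bar>) = ennreal (1 / c) * average Q (\<lambda>y. ennreal \<bar>f y\<bar>)"
    if "Q \<in> cubes" for Q
  proof -
    have Q [measurable]: "Q \<in> sets lebesgue" using that by (auto simp: cubes_def)
    have "(\<integral>\<^sup>+y\<in>Q. ennreal \<bar>f y / c\<bar> \<partial>lebesgue) =
        (\<integral>\<^sup>+y. ennreal (1 / c) * (ennreal \<bar>f y\<bar> * indicator Q y) \<partial>lebesgue)"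
      using assms(2) by (intro nn_integral_cong) (simp add: abs_div_pos[symmetric] ennreal_mult[symmetric] mult.assoc[symmetric])
    also have "\<dots> = ennreal (1 / c) * (\<integral>\<^sup>+y\<in>Q. ennreal \<bar>f y\<bar> \<partial>lebesgue)"
      by (intro nn_integral_cmult) measurable
    finally show ?thesis by (simp add: average_def ennreal_times_divide)
  qed
  then have "maximal_op (\<lambda>y. f y / c) x =
      (SUP Q\<in>{Q\<in>cubes. x \<in> Q}. ennreal (1 / c) * average Q (\<lambda>y. ennreal \<bar>f y\<bar>))"
    unfolding maximal_op_def by (intro SUP_cong) auto
  also have "\<dots> = ennreal (1 / c) * maximal_op f x"
    unfolding maximal_op_def by (rule SUP_mult_left_ennreal[symmetric])
  also have "\<dots> = maximal_op f x / ennreal c"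
    using assms(2) by (simp add: divide_ennreal_def inverse_ennreal inverse_eq_divide mult.commute)
  finally show ?thesis .
qed

lemma Lp_norm_le:
  assumes "0 < c" "modular p (\<lambda>x. g x / ennreal c) \<le> 1"
  shows "Lp_norm p g \<le> ennreal c"
  unfolding Lp_norm_def using assms by (intro Inf_lower) auto

lemma ennreal_divide_antimono:
  assumes "0 < b" "b \<le> c"
  shows "a / ennreal c \<le> a / ennreal b"
  unfolding divide_ennreal_def using assms
  by (intro mult_left_mono) (auto simp: inverse_ennreal le_imp_inverse_le intro!: ennreal_leI)

lemma modular_mono:
  assumes "AE x in lebesgue. 0 < p x \<and> g x \<le> h x"
  shows "modular p g \<le> modular p h"
  unfolding modular_def using assms by (intro nn_integral_mono_AE) (auto intro: epowr_mono)

lemma maximal_op_bounded_modular: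
  fixes p w :: "real^'n \<Rightarrow> real"
  assumes "maximal_op_bounded p (\<lambda>x. ennreal (w x))"
    and p: "\<And>x. 1 \<le> p x" and w: "\<And>x. 0 \<le> w x"
  obtains C where "1 \<le> C" "\<And>f. f \<in> borel_measurable lebesgue \<Longrightarrow> (\<And>x. 0 \<le> f x) \<Longrightarrow>
      (\<integral>\<^sup>+x. ennreal ((f x * w x) powr p x) \<partial>lebesgue) \<le> 1 \<Longrightarrow>
      modular p (\<lambda>x. maximal_op f x * ennreal (w x) / ennreal C) \<le> 1"
proof -
  obtain C0 where C0: "0 < C0" "\<And>f. f \<in> weighted_Lp p (\<lambda>x. ennreal (w x)) \<Longrightarrow>
      weighted_Lp_norm p (\<lambda>x. ennreal (w x)) (maximal_op f)
        \<le> ennreal C0 * weighted_Lp_norm p (\<lambda>x. ennreal (w x)) (\<lambda>x. ennreal \<bar>f x\<bar>)"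
    using assms(1) unfolding maximal_op_bounded_def by blast
  show ?thesis
  proof (rule that[of "C0 + 1"])
    show "1 \<le> C0 + 1" using C0(1) by simp
    fix f :: "real^'n \<Rightarrow> real"
    assume f: "f \<in> borel_measurable lebesgue" "\<And>x. 0 \<le> f x"
      "(\<integral>\<^sup>+x. ennreal ((f x * w x) powr p x) \<partial>lebesgue) \<le> 1"
    have eq: "epowr (ennreal \<bar>f x\<bar> * ennreal (w x) / ennreal 1) (p x) = ennreal ((f x * w x) powr p x)" for x
      using epowr_ennreal[of "f x * w x" "p x"] f(2)[of x] w[of x] p[of x]
      by (simp add: ennreal_mult[symmetric] divide_ennreal_def)
    have mod1: "modular p (\<lambda>x. ennreal \<bar>f x\<bar> * ennreal (w x) / ennreal 1) \<le> 1"
      unfolding modular_def eq by (rule f(3))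
    have "modular p (\<lambda>x. ennreal \<bar>f x\<bar> * ennreal (w x) / ennreal 1) < \<infinity>"
      using order.strict_trans1[OF mod1 ennreal_one_less_top] by simp
    then have "f \<in> weighted_Lp p (\<lambda>x. ennreal (w x))"
      unfolding weighted_Lp_def using f(1) by (intro CollectI conjI exI[of _ "1::real"]) auto
    then have "weighted_Lp_norm p (\<lambda>x. ennreal (w x)) (maximal_op f)
        \<le> ennreal C0 * weighted_Lp_norm p (\<lambda>x. ennreal (w x)) (\<lambda>x. ennreal \<bar>f x\<bar>)" by (rule C0(2))
    also have "\<dots> \<le> ennreal C0 * ennreal 1"
      unfolding weighted_Lp_norm_def using mod1 by (intro mult_left_mono Lp_norm_le) auto
    \<comment> \<open>The strict slack yields an admissible \<open>c\<close> below
      \<open>C0 + 1\<close>, so the infimum in the norm need not be attained.\<close>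
    also have "\<dots> < ennreal (C0 + 1)" using C0(1) by (simp add: ennreal_less_iff)
    finally obtain c where c: "0 < c" "ennreal c < ennreal (C0 + 1)"
      "modular p (\<lambda>x. maximal_op f x * ennreal (w x) / ennreal c) \<le> 1"
      unfolding weighted_Lp_norm_def Lp_norm_def Inf_less_iff by blast
    have "c \<le> C0 + 1" using c(1,2) by (simp add: ennreal_less_iff)
    then have "modular p (\<lambda>x. maximal_op f x * ennreal (w x) / ennreal (C0 + 1)) \<le>
        modular p (\<lambda>x. maximal_op f x * ennreal (w x) / ennreal c)"
      using p c(1) less_le_trans[OF zero_less_one p] by (intro modular_mono AE_I2 conjI ennreal_divide_antimono) auto
    then show "modular p (\<lambda>x. maximal_op f x * ennreal (w x) / ennreal (C0 + 1)) \<le> 1"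
      using c(3) by simp
  qed
qed

text \<open>Since t / (t - 1) decreases in t, a constant c > 1 below the essential infimum bounds
  the conjugate exponent by c / (c - 1).\<close>

lemma exponent_bounds:
  fixes p :: "real^'n \<Rightarrow> real"
  assumes p: "p \<in> borel_measurable lebesgue"
    and p_minus: "essinf lebesgue (\<lambda>x. ereal (p x)) > 1"
    and p_plus: "esssup lebesgue (\<lambda>x. ereal (p x)) < \<infinity>"
  obtains P where "1 \<le> P" "AE x in lebesgue. 1 < p x \<and> p x \<le> P \<and> conj_exponent p x \<le> P"
proof -
  have "(\<lambda>x. ereal (p x)) \<in> borel_measurable lebesgue" using p by measurable
  then have "1 < Liminf (ae_filter lebesgue) (\<lambda>x. ereal (p x))" using p_minus by (simp add: essinf_def)
  then obtain c where c: "1 < ereal c" "ereal c < Liminf (ae_filter lebesgue) (\<lambda>x. ereal (p x))"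
    using ereal_dense2 by blast
  have lower: "AE x in lebesgue. c < p x" using less_LiminfD[OF c(2)] by simp
  have c1: "1 < c" using c(1) by (simp add: one_ereal_def)
  obtain b where b: "esssup lebesgue (\<lambda>x. ereal (p x)) < ereal b" using ereal_dense2[OF p_plus] by blast
  have upper: "AE x in lebesgue. p x \<le> b"
    using esssup_AE[of "\<lambda>x. ereal (p x)" lebesgue]
  proof eventually_elim
    case (elim x)
    then show ?case using b by (metis ereal_less_eq(3) less_imp_le order.trans)
  qed
  show ?thesis
  proof (rule that[of "max b (c / (c - 1))"])
    show "1 \<le> max b (c / (c - 1))" using c1 by (simp add: le_max_iff_disj)
    show "AE x in lebesgue. 1 < p x \<and> p x \<le> max b (c / (c - 1)) \<and> conj_exponent p x \<le> max b (c / (c - 1))"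
      using lower upper
    proof eventually_elim
      case (elim x)
      have "p x / (p x - 1) \<le> c / (c - 1)" using elim c1 by (simp add: divide_simps algebra_simps)
      then show ?case using elim c1 by (auto simp: conj_exponent_def)
    qed
  qed
qed

text \<open>A negative power is infinite where \<open>w\<close> vanishes, and integrability on every
  ball of integer radius makes it finite almost everywhere.\<close>

lemma weight_positive_AE:
  fixes p w :: "real^'n \<Rightarrow> real"
  assumes loc: "locally_integrable (\<lambda>x. epowr (ennreal (w x)) (- conj_exponent p x))"
    and w: "\<And>x. 0 \<le> w x" and p: "AE x in lebesgue. 1 < p x"
  shows "AE x in lebesgue. 0 < w x"
proof -
  let ?s = "\<lambda>x. epowr (ennreal (w x)) (- conj_exponent p x)"
  have meas: "?s \<in> borel_measurable lebesgue" using loc by (simp add: locally_integrable_def)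
  have "AE x in lebesgue. \<forall>k::nat. ?s x * indicator (cball 0 (real k)) x \<noteq> \<infinity>"
    unfolding AE_all_countable
  proof
    fix k :: nat
    have "(\<integral>\<^sup>+x\<in>cball 0 (real k). ?s x \<partial>lebesgue) < \<infinity>"
      using loc by (simp add: locally_integrable_def)
    moreover have "cball (0 :: real^'n) (real k) \<in> sets lebesgue"
      using lmeasurable_cball by (rule fmeasurableD)
    ultimately show "AE x in lebesgue. ?s x * indicator (cball 0 (real k)) x \<noteq> \<infinity>"
      using meas by (intro nn_integral_PInf_AE borel_measurable_times_ennreal borel_measurable_indicator) auto
  qed
  then show ?thesis
    using p
  proof eventually_elim
    case (elim x)
    obtain k :: nat where "norm x \<le> real k" using real_arch_simple by blast
    then have "?s x \<noteq> \<infinity>" using spec[OF elim(1), of k] by (simp add: indicator_def)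
    moreover have "0 < conj_exponent p x" using elim(2) by (simp add: conj_exponent_def)
    ultimately have "w x \<noteq> 0" by (auto simp: epowr_def)
    then show ?case using w[of x] by simp
  qed
qed

theorem theorem1p1:
  fixes p w :: "real^'n \<Rightarrow> real"
  assumes p_measurable: "p \<in> borel_measurable lebesgue"
    and p_ge_1: "\<forall>x. 1 \<le> p x"
    and p_minus: "essinf lebesgue (\<lambda>x. ereal (p x)) > 1"
    and p_plus: "esssup lebesgue (\<lambda>x. ereal (p x)) < \<infinity>"
    and weight: "is_weight p w"
    and A_inf: "(\<lambda>x. epowr (ennreal (w x)) (p x)) \<in> Muckenhoupt_A_inf"
    and bounded: "maximal_op_bounded p (\<lambda>x. ennreal (w x))"
  shows "maximal_op_bounded (conj_exponent p) (\<lambda>x. inverse (ennreal (w x)))"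
proof -
  have p1: "1 \<le> p x" for x using p_ge_1 by blast
  have w0: "0 \<le> w x" for x using weight by (simp add: is_weight_def)
  have loc: "locally_integrable (\<lambda>x. epowr (ennreal (w x)) (p x))"
    "locally_integrable (\<lambda>x. epowr (ennreal (w x)) (- conj_exponent p x))"
    using weight by (simp_all add: is_weight_def)
  have wp: "epowr (ennreal (w x)) (p x) = ennreal (w x powr p x)" for x
    using p1[of x] w0[of x] by (intro epowr_ennreal) auto
  obtain P where P: "1 \<le> P" "AE x in lebesgue. 1 < p x \<and> p x \<le> P \<and> conj_exponent p x \<le> P"
    using exponent_bounds[OF p_measurable p_minus p_plus] by blast
  have pgt1: "AE x in lebesgue. 1 < p x" using P(2) by eventually_elim auto
  have wpos: "AE x in lebesgue. 0 < w x" using weight_positive_AE[OF loc(2) w0 pgt1] .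
  obtain C where C: "1 \<le> C" "\<And>f. f \<in> borel_measurable lebesgue \<Longrightarrow> (\<And>x. 0 \<le> f x) \<Longrightarrow>
      (\<integral>\<^sup>+x. ennreal ((f x * w x) powr p x) \<partial>lebesgue) \<le> 1 \<Longrightarrow>
      modular p (\<lambda>x. maximal_op f x * ennreal (w x) / ennreal C) \<le> 1"
    using maximal_op_bounded_modular[OF bounded p1 w0] by blast
  have dual_weight: "epowr (ennreal (w x)) (- conj_exponent p x) = ennreal ((1 / w x) powr conj_exponent p x)"
    if "0 < w x" "1 < p x" for x
  proof -
    have "0 < conj_exponent p x" using that by (simp add: conj_exponent_def)
    then show ?thesis using that
      by (simp add: epowr_def powr_minus powr_divide inverse_eq_divide ennreal_eq_0_iff)
  qed
  have compact_integrable: "(\<integral>\<^sup>+x\<in>hcube a l. v x \<partial>lebesgue) < \<infinity>" if "locally_integrable v"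
    for a :: "real^'n" and l v
    using that unfolding nn_integral_hcube locally_integrable_def by (auto simp: compact_cbox)
  interpret weighted_exponent p w P C
  proof
    show "p \<in> borel_measurable lebesgue" by (rule p_measurable)
    show "w \<in> borel_measurable lebesgue"
    proof -
      \<comment> \<open>\<open>is_weight\<close> speaks of powers of \<open>w\<close> only; the
        power 1/p of w^p recovers \<open>w\<close> itself.\<close>
      have "(\<lambda>x. enn2real (epowr (ennreal (w x)) (p x)) powr (1 / p x)) \<in> borel_measurable lebesgue"
        using loc(1) p_measurable unfolding locally_integrable_def
        by (intro powr_real_measurable borel_measurable_divide borel_measurable_const measurable_compose[OF _ borel_measurable_enn2real]) auto
      also have "(\<lambda>x. enn2real (epowr (ennreal (w x)) (p x)) powr (1 / p x)) = w"
      proof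
        fix x
        show "enn2real (epowr (ennreal (w x)) (p x)) powr (1 / p x) = w x"
          unfolding wp using p1[of x] w0[of x] by (simp add: powr_powr)
      qed
      finally show ?thesis .
    qed
    show "AE x in lebesgue. 0 < w x \<and> 1 < p x \<and> p x \<le> P \<and> conj_exponent p x \<le> P"
      using wpos P(2) by eventually_elim auto
    show "(\<integral>\<^sup>+x\<in>hcube a l. ennreal (w x powr p x) \<partial>lebesgue) < \<infinity>" for a l
      using compact_integrable[OF loc(1)] unfolding wp .
    show "(\<integral>\<^sup>+x\<in>hcube a l. ennreal ((1 / w x) powr conj_exponent p x) \<partial>lebesgue) < \<infinity>" for a l
    proof -
      have "(\<integral>\<^sup>+x\<in>hcube a l. ennreal ((1 / w x) powr conj_exponent p x) \<partial>lebesgue) =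
          (\<integral>\<^sup>+x\<in>hcube a l. epowr (ennreal (w x)) (- conj_exponent p x) \<partial>lebesgue)"
        using wpos pgt1 by (intro nn_integral_cong_AE, eventually_elim) (simp add: dual_weight)
      then show ?thesis using compact_integrable[OF loc(2)] by simp
    qed
  qed (use p1 w0 P(1) C in auto)
  define K where "K = dual_bound_const"
  have K: "0 < K" unfolding K_def by (rule dual_bound_const_pos)
  let ?v = "\<lambda>x. inverse (ennreal (w x))"
  show ?thesis
    unfolding maximal_op_bounded_def
  proof (intro exI conjI ballI)
    show "0 < K" by (rule K)
    fix f assume "f \<in> weighted_Lp q ?v"
    then have f: "f \<in> borel_measurable lebesgue" by (simp add: weighted_Lp_def)
    \<comment> \<open>For each \<open>c\<close> admissible in the norm of \<open>f\<close>, the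
      modular bound is applied to f / c. With \<open>K\<close> moved to the left, the infimum over
      \<open>c\<close> can then be taken on the right.\<close>
    have le: "weighted_Lp_norm q ?v (maximal_op f) / ennreal K \<le> ennreal c"
      if c: "0 < c" "modular q (\<lambda>x. ennreal \<bar>f x\<bar> * ?v x / ennreal c) \<le> 1" for c
    proof -
      have "(\<integral>\<^sup>+x. ennreal ((\<bar>f x / c\<bar> / w x) powr q x) \<partial>lebesgue) =
          modular q (\<lambda>x. ennreal \<bar>f x\<bar> * ?v x / ennreal c)"
        unfolding modular_def
      proof (rule nn_integral_cong_AE)
        show "AE x in lebesgue. ennreal ((\<bar>f x / c\<bar> / w x) powr q x) = epowr (ennreal \<bar>f x\<bar> * ?v x / ennreal c) (q x)"
          using regular
        proof eventually_elim
          case (elim x)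
          have "ennreal \<bar>f x\<bar> * ?v x / ennreal c = ennreal (\<bar>f x / c\<bar> / w x)"
            using elim c(1) by (simp add: inverse_ennreal ennreal_mult[symmetric] divide_ennreal abs_div_pos[symmetric] field_simps)
          then show ?case using elim conj_identities(1)[of x] epowr_ennreal[of "\<bar>f x / c\<bar> / w x" "q x"] by simp
        qed
      qed
      then have "modular q (\<lambda>x. maximal_op (\<lambda>y. f y / c) x * ?v x / ennreal K) \<le> 1"
        unfolding K_def using f c(2) by (intro dual_maximal) auto
      moreover have "maximal_op (\<lambda>y. f y / c) x * ?v x / ennreal K = maximal_op f x * ?v x / ennreal (K * c)" for x
      proof -
        have "inverse (ennreal (K * c)) = inverse (ennreal K) * inverse (ennreal c)"
          using K c(1) by (simp add: inverse_ennreal ennreal_mult[symmetric])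
        then show ?thesis unfolding maximal_op_scale[OF f c(1)] divide_ennreal_def by (simp add: mult_ac)
      qed
      ultimately have "weighted_Lp_norm q ?v (maximal_op f) \<le> ennreal (K * c)"
        unfolding weighted_Lp_norm_def using K c(1) by (intro Lp_norm_le) auto
      then have "weighted_Lp_norm q ?v (maximal_op f) / ennreal K \<le> ennreal (K * c) / ennreal K"
        by (rule divide_right_mono_ennreal)
      also have "\<dots> = ennreal c" using K c(1) by (simp add: divide_ennreal)
      finally show ?thesis .
    qed
    have "weighted_Lp_norm q ?v (maximal_op f) / ennreal K \<le> weighted_Lp_norm q ?v (\<lambda>x. ennreal \<bar>f x\<bar>)"
      unfolding weighted_Lp_norm_def[of q ?v "\<lambda>x. ennreal \<bar>f x\<bar>"] Lp_norm_def
      using le by (intro Inf_greatest) blast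
    then have "ennreal K * (weighted_Lp_norm q ?v (maximal_op f) / ennreal K) \<le>
        ennreal K * weighted_Lp_norm q ?v (\<lambda>x. ennreal \<bar>f x\<bar>)" by (rule mult_left_mono) simp
    moreover have "ennreal K * (weighted_Lp_norm q ?v (maximal_op f) / ennreal K) = weighted_Lp_norm q ?v (maximal_op f)"
      using K by (simp add: ennreal_times_divide mult.commute[of "ennreal K"] mult_divide_eq_ennreal)
    ultimately show "weighted_Lp_norm q ?v (maximal_op f) \<le> ennreal K * weighted_Lp_norm q ?v (\<lambda>x. ennreal \<bar>f x\<bar>)"
      by simp
  qed
qed

end
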